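(* Let $K\ge1$ and $f\in\mathcal{S}_{H}(K,G)$, where $G$ is a bounded Pommerenke interior domain. If there are constants $C_6>0$, $C_7>0$, $\delta_3>0$ and $\delta_4\in(0,1)$ such that, for each $\zeta\in\partial\mathbb{D}$ and for $0\le\rho_1\le\rho_2<1$, $$C_6\left(\frac{1-\rho_1}{1-\rho_2}\right)^{\delta_3-1}\|D_f(\rho_1\zeta)\|\le\|D_f(\rho_2\zeta)\|\le C_7\left(\frac{1-\rho_2}{1-\rho_1}\right)^{\delta_4-1}\|D_f(\rho_1\zeta)\|,$$ then $$\sup_{\zeta\in\mathbb{D}}\frac{1}{2\pi}\int_{\partial\mathbb{D}}\frac{\|D_f(\xi)\|}{\|D_f(\zeta)\|}\,\frac{1-|\zeta|^2}{|\xi-\zeta|^2}\,|d\xi|<\infty.$$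
   Context: $\mathbb{D}=\{z\in\mathbb{C}:|z|<1\}$, $\mathbb{D}_r=\{z:|z|<r\}$. $\mathcal{S}_H$ is the family of sense-preserving harmonic univalent mappings $f=h+\overline{g}$ in $\mathbb{D}$, with $h,g$ analytic, $h(0)=g(0)=0$, $h'(0)=1$. Write $\|D_f\|=|f_z|+|f_{\overline z}|$. A sense-preserving homeomorphism $f$ of class $W^{1,2}_{loc}$ between domains is $K$-quasiconformal if $\|D_f(z)\|^2\le K\big||f_z|^2-|f_{\overline z}|^2\big|$. $\mathcal{S}_{H}(K,G)$ is the set of $K$-quasiconformal $f\in\mathcal{S}_{H}$ with $f(\mathbb{D})=G$. Pommerenke interior domain: let $f\in\mathcal{S}_H$ be $K$-quasiconformal with $f(\mathbb{D})=G$. For $0<r<1$ let $G_r=f(\mathbb{D}_r)$; for distinct $w_1,w_2\in f(\partial\mathbb{D}_r)$ let $\gamma_r[w_1,w_2]$ be the smaller (shorter) subarc of $f(\partial\mathbb{D}_r)$ between $w_1$ and $w_2$, $\ell(\gamma_r[w_1,w_2])$ its length, and $d_{G_r}(w_1,w_2)=\inf_\Gamma\operatorname{diam}\Gamma$, where $\Gamma$ runs through all arcs from $w_1$ to $w_2$ that lie in $G_r$ except for their endpoints. $G$ is a Pommerenke interior domain (with respect to $f$) if $$\sup_{0<r<1}\ \sup_{w_1,w_2}\frac{\ell(\gamma_r[w_1,w_2])}{d_{G_r}(w_1,w_2)}<\infty,$$ and a bounded Pommerenke interior domain if in addition $G$ is bounded. For $\xi\in\partial\mathbb{D}$, $\|D_f(\xi)\|$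 denotes the radial limit $\lim_{r\to1^-}\|D_f(r\xi)\|$ (defined almost everywhere). *)

theory Defs
  imports "HOL-Complex_Analysis.Complex_Analysis"
begin

section \<open>Wirtinger derivatives\<close>

definition wirt_dz :: "(complex \<Rightarrow> complex) \<Rightarrow> complex \<Rightarrow> complex" where
  "wirt_dz f z = (frechet_derivative f (at z) 1 - \<i> * frechet_derivative f (at z) \<i>) / 2"

definition wirt_dzbar :: "(complex \<Rightarrow> complex) \<Rightarrow> complex \<Rightarrow> complex" where
  "wirt_dzbar f z = (frechet_derivative f (at z) 1 + \<i> * frechet_derivative f (at z) \<i>) / 2"

definition norm_D :: "(complex \<Rightarrow> complex) \<Rightarrow> complex \<Rightarrow> real" where
  "norm_D f z = cmod (wirt_dz f z) + cmod (wirt_dzbar f z)"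

definition norm_D_bdry :: "(complex \<Rightarrow> complex) \<Rightarrow> complex \<Rightarrow> real" where
  "norm_D_bdry f \<xi> = Lim (at_left 1) (\<lambda>r. norm_D f (of_real r * \<xi>))"


section \<open>Quasiconformal mappings\<close>

definition plane_domain :: "complex set \<Rightarrow> bool" where
  "plane_domain U \<longleftrightarrow> open U \<and> connected U \<and> U \<noteq> {}"

text \<open>Orientation of an injective continuous map, expressed by its local degree; no
  differentiability is needed, so that the notion applies to homeomorphisms.\<close>

definition sense_preserving_on :: "(complex \<Rightarrow> complex) \<Rightarrow> complex set \<Rightarrow> bool" where
  "sense_preserving_on f U \<longleftrightarrow>
     (\<forall>z r. 0 < r \<and> cball z r \<subseteq> U \<longrightarrow> winding_number (f \<circ> circlepath z r) (f z) = 1)"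

text \<open>A function is smooth iff it is differentiable and all its directional
  derivatives are smooth again.\<close>

coinductive smooth_fun :: "(complex \<Rightarrow> real) \<Rightarrow> bool" where
  "(\<And>z. \<phi> differentiable (at z)) \<Longrightarrow>
   (\<And>v. smooth_fun (\<lambda>z. frechet_derivative \<phi> (at z) v)) \<Longrightarrow> smooth_fun \<phi>"

definition test_fun_on :: "(complex \<Rightarrow> real) \<Rightarrow> complex set \<Rightarrow> bool" where
  "test_fun_on \<phi> U \<longleftrightarrow>
     smooth_fun \<phi> \<and> compact (closure {z. \<phi> z \<noteq> 0}) \<and> closure {z. \<phi> z \<noteq> 0} \<subseteq> U"

definition L2_loc_on :: "(complex \<Rightarrow> complex) \<Rightarrow> complex set \<Rightarrow> bool" where
  "L2_loc_on f U \<longleftrightarrow>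
     (\<forall>C. compact C \<and> C \<subseteq> U \<longrightarrow>
        set_borel_measurable lborel C f \<and> set_integrable lborel C (\<lambda>z. (cmod (f z))\<^sup>2))"

definition weak_derivative_on ::
    "complex \<Rightarrow> (complex \<Rightarrow> complex) \<Rightarrow> (complex \<Rightarrow> complex) \<Rightarrow> complex set \<Rightarrow> bool" where
  "weak_derivative_on v f u U \<longleftrightarrow>
     (\<forall>\<phi>. test_fun_on \<phi> U \<longrightarrow>
        (LINT z:U|lborel. frechet_derivative \<phi> (at z) v *\<^sub>R f z)
          = - (LINT z:U|lborel. \<phi> z *\<^sub>R u z))"

definition W12_loc_on :: "(complex \<Rightarrow> complex) \<Rightarrow> complex set \<Rightarrow> bool" where
  "W12_loc_on f U \<longleftrightarrow>
     L2_loc_on f U \<and>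
     (\<exists>p q. L2_loc_on p U \<and> weak_derivative_on 1 f p U \<and>
            L2_loc_on q U \<and> weak_derivative_on \<i> f q U)"

text \<open>Planar homeomorphisms of class \<open>W\<^sup>1\<^sup>,\<^sup>2\<close> (locally) are differentiable almost everywhere
  (Gehring--Lehto) and their weak derivatives are the classical ones, so the dilatation
  inequality is imposed on the classical derivative almost everywhere.\<close>

definition quasiconformal :: "real \<Rightarrow> (complex \<Rightarrow> complex) \<Rightarrow> complex set \<Rightarrow> complex set \<Rightarrow> bool" where
  "quasiconformal K f U V \<longleftrightarrow>
     plane_domain U \<and> plane_domain V \<and> (\<exists>g. homeomorphism U V f g) \<and>
     sense_preserving_on f U \<and> W12_loc_on f U \<and>
     (AE z\<in>U in lborel. f differentiable (at z) \<and>
        (norm_D f z)\<^sup>2 \<le> K * \<bar>(cmod (wirt_dz f z))\<^sup>2 - (cmod (wirt_dzbar f z))\<^sup>2\<bar>)"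


section \<open>Univalent harmonic mappings of the unit disc\<close>

definition S_H :: "(complex \<Rightarrow> complex) set" where
  "S_H = {f. inj_on f (ball 0 1) \<and> sense_preserving_on f (ball 0 1) \<and>
     (\<exists>h g. h holomorphic_on ball 0 1 \<and> g holomorphic_on ball 0 1 \<and>
            h 0 = 0 \<and> g 0 = 0 \<and> deriv h 0 = 1 \<and>
            (\<forall>z\<in>ball 0 1. f z = h z + cnj (g z)))}"

definition S_HK :: "real \<Rightarrow> complex set \<Rightarrow> (complex \<Rightarrow> complex) set" where
  "S_HK K G = {f \<in> S_H. f ` ball 0 1 = G \<and> quasiconformal K f (ball 0 1) G}"


section \<open>Pommerenke interior domains\<close>

text \<open>Length of the arc \<open>t \<mapsto> f (r e\<^sup>i\<^sup>t)\<close>, \<open>a \<le> t \<le> b\<close>; the map \<open>f\<close> is smooth on the circle.\<close>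

definition circ_image_length :: "(complex \<Rightarrow> complex) \<Rightarrow> real \<Rightarrow> real \<Rightarrow> real \<Rightarrow> real" where
  "circ_image_length f r a b =
     integral {a..b} (\<lambda>t. norm (vector_derivative (\<lambda>t. f (rcis r t)) (at t)))"

text \<open>For distinct points \<open>w1\<close>, \<open>w2\<close> of the Jordan curve \<open>f ` sphere 0 r\<close> the set below consists of
  the lengths of the two complementary subarcs between them.\<close>

definition smaller_subarc_length ::
    "(complex \<Rightarrow> complex) \<Rightarrow> real \<Rightarrow> complex \<Rightarrow> complex \<Rightarrow> real" where
  "smaller_subarc_length f r w1 w2 =
     Inf {circ_image_length f r s t | s t.
            s < t \<and> t < s + 2 * pi \<and> {f (rcis r s), f (rcis r t)} = {w1, w2}}"

definition internal_dist :: "complex set \<Rightarrow> complex \<Rightarrow> complex \<Rightarrow> real" where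
  "internal_dist G w1 w2 =
     Inf {diameter (path_image \<gamma>) | \<gamma>.
            arc \<gamma> \<and> pathstart \<gamma> = w1 \<and> pathfinish \<gamma> = w2 \<and> path_image \<gamma> - {w1, w2} \<subseteq> G}"

definition pommerenke_interior_domain ::
    "real \<Rightarrow> (complex \<Rightarrow> complex) \<Rightarrow> complex set \<Rightarrow> bool" where
  "pommerenke_interior_domain K f G \<longleftrightarrow>
     f \<in> S_HK K G \<and>
     bdd_above {smaller_subarc_length f r w1 w2 / internal_dist (f ` ball 0 r) w1 w2 | r w1 w2.
                  0 < r \<and> r < 1 \<and> w1 \<in> f ` sphere 0 r \<and> w2 \<in> f ` sphere 0 r \<and> w1 \<noteq> w2}"

definition bounded_pommerenke_interior_domain ::
    "real \<Rightarrow> (complex \<Rightarrow> complex) \<Rightarrow> complex set \<Rightarrow> bool" where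
  "bounded_pommerenke_interior_domain K f G \<longleftrightarrow>
     pommerenke_interior_domain K f G \<and> bounded G"

end

theory Submission
  imports Defs
begin

text \<open>
  Write \<open>f = h + cnj g\<close>; then \<open>norm_D f = |h'| + |g'|\<close> is comparable to \<open>|p|\<close>, where \<open>p\<close> is the
  dominating one of \<open>h'\<close>, \<open>g'\<close>, a zero-free holomorphic function. The two-sided radial condition
  bounds \<open>p(w) / p(s w)\<close> on discs of hyperbolic radius about 1, so \<open>p'/p\<close> is \<open>O(1 / (1 - |z|))\<close> and \<open>|p|\<close>
  is also comparable in tangential directions. Hence \<open>f\<close> maps the box of size \<open>1 - \<rho>\<close> at
  \<open>z = \<rho> cis \<theta>\<close> into a disc of radius \<open>C (1 - \<rho>) norm_D f z\<close>, and the Pommerenke condition turns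
  this diameter bound into the length bound
  \<open>\<integral> norm_D f (r cis t) dt \<le> C (1 - \<rho>) norm_D f z\<close> over \<open>|t - \<theta>| \<le> \<pi> (1 - \<rho>)\<close>, uniformly in \<open>r\<close>.
  Summing over dyadic arcs against the Poisson kernel, the lower radial bound with exponent
  \<open>\<delta>3 > 0\<close> makes the series geometric. Fatou's lemma then passes to \<open>r \<rightarrow> 1\<close>.

  As \<open>norm_D_bdry\<close> is an arbitrary value where the radial limit does not exist, the existence of
  the limit almost everywhere has to be proved. It follows from Fatou's theorem for the Hardy space
  \<open>H\<^sup>2\<close>, applied to \<open>sqrt p\<close> (by the length bound at \<open>\<rho> = 0\<close>) and to the bounded quotient \<open>q / p\<close> of the
  two analytic parts.
\<close>

section \<open>The Poisson kernel and the maximal function\<close>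

text \<open>All estimates are made on circles of radius \<open>r < 1\<close>, where \<open>f\<close>
  is smooth and the Pommerenke condition is stated, with constants free of \<open>r\<close>. The
  decisive uses of the exponents are these. As \<delta>4 > 0, the majorant
  \<open>(1 - s) powr (\<delta>4 - 1)\<close> is integrable up to \<open>s = 1\<close>, so radial
  increments of \<open>f\<close> stay bounded at the boundary. In the Poisson sum the kernel
  contributes \<open>4^-n\<close>, the n-th arc \<open>2^n\<close>, and the stretch at the n-th
  height at most \<open>2^(n * (1 - \<delta>3))\<close> when \<delta>3 \<le> 1; what remains is
  \<open>2^(-n * \<delta>3)\<close>. For the radial limits, the length bound controls
  \<open>p\<close> only in the mean of its modulus. Having no zeros, \<open>p\<close> has a
  holomorphic square root, for which Parseval's identity is available and yields small tails. The
  maximal inequality that turns small tails into convergence rests on the same dyadic splitting of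
  the Poisson kernel as the main estimate; hence the splitting is stated for an arbitrary density
  \<open>u\<close> and arbitrary window bounds \<open>A n\<close>.\<close>

lemma nn_integral_Icc_continuous:
  fixes u :: "real \<Rightarrow> real"
  assumes "continuous_on {a..b} u" "\<And>t. t \<in> {a..b} \<Longrightarrow> 0 \<le> u t"
  shows "(\<integral>\<^sup>+t\<in>{a..b}. ennreal (u t) \<partial>lborel) = ennreal (integral {a..b} u)"
proof -
  have i: "set_integrable lborel {a..b} u"
    using borel_integrable_compact[OF _ assms(1)] by (auto simp: set_integrable_def indicator_def if_distrib cong: if_cong)
  have eq: "(LINT t:{a..b}|lborel. u t) = integral {a..b} u"
    using set_borel_integral_eq_integral(2)[OF i] .
  have "(\<integral>\<^sup>+t\<in>{a..b}. ennreal (u t) \<partial>lborel) = (\<integral>\<^sup>+t. ennreal (indicator {a..b} t *\<^sub>R u t) \<partial>lborel)"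
    by (intro nn_integral_cong) (auto simp: indicator_def)
  also have "\<dots> = ennreal (LINT t:{a..b}|lborel. u t)"
    unfolding set_lebesgue_integral_def
    using i assms(2) by (intro nn_integral_eq_integral) (auto simp: set_integrable_def indicator_def)
  finally show ?thesis using eq by simp
qed

section \<open>Dyadic bounds for the Poisson kernel\<close>

lemma norm_cis_minus_1: "cmod (cis t - 1) = 2 * \<bar>sin (t/2)\<bar>"
proof -
  have "(cmod (cis t - 1))\<^sup>2 = (2 * \<bar>sin (t/2)\<bar>)\<^sup>2"
    using cos_double_sin[of "t/2"] sin_cos_squared_add[of t]
    by (simp add: cmod_power2 power2_diff)
  thus ?thesis using power2_eq_iff_nonneg[of "cmod (cis t - 1)" "2 * \<bar>sin (t/2)\<bar>"] by auto
qed

lemma norm_cis_minus_1_ge: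
  assumes "\<bar>t\<bar> \<le> pi"
  shows "2 * \<bar>t\<bar> / pi \<le> cmod (cis t - 1)"
proof -
  \<comment> \<open>Jordan's inequality: the concave sine lies above its chord from \<open>0\<close>
    to \<open>pi/2\<close>.\<close>
  have "x * (2/pi) \<le> sin x" if "0 \<le> x" "x \<le> pi/2" for x
  proof -
    have "concave_on {0..pi/2} sin"
    proof (rule f''_le0_imp_concave[where f'=cos and f''="\<lambda>x. - sin x"])
      show "- sin x \<le> 0" if "x \<in> {0..pi/2}" for x::real
        using that sin_ge_zero[of x] pi_ge_zero by (auto simp del: pi_ge_zero)
    qed (auto intro!: derivative_eq_intros)
    hence "sin ((1 - x*(2/pi)) *\<^sub>R 0 + (x*(2/pi)) *\<^sub>R (pi/2)) \<ge> (1 - x*(2/pi)) * sin 0 + (x*(2/pi)) * sin (pi/2)"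
      using that by (intro concave_onD) (auto simp: field_simps)
    thus ?thesis by simp
  qed
  from this[of "\<bar>t\<bar>/2"] assms have "\<bar>t\<bar>/2 * (2/pi) \<le> sin (\<bar>t\<bar>/2)" by simp
  also have "\<dots> \<le> \<bar>sin (t/2)\<bar>" by (cases "t \<ge> 0") auto
  finally show ?thesis by (simp add: norm_cis_minus_1)
qed

text \<open>Take the least \<open>n\<close> with \<open>|\<tau>| \<le> pi * 2^n * (1 - r)\<close>.
  Minimality keeps \<open>cis \<tau>\<close> at distance at least \<open>2^n * (1 - r) / 2\<close>
  from \<open>r\<close>, and \<open>1 - r^2 \<le> 2 * (1 - r)\<close> over the square of that
  distance gives the constant 8. The \<open>min\<close> with 1 caps the windows at a full
  period.\<close>

lemma poisson_kernel_dyadic: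
  fixes r \<tau> :: real
  assumes r: "0 \<le> r" "r < 1" and \<tau>: "\<bar>\<tau>\<bar> \<le> pi"
  shows "\<exists>n. \<bar>\<tau>\<bar> \<le> pi * min (2^n * (1 - r)) 1 \<and>
             (1 - r\<^sup>2) / (cmod (cis \<tau> - of_real r))\<^sup>2 \<le> 8 / (4^n * (1 - r))"
proof -
  define d where "d = 1 - r"
  have d: "0 < d" "d \<le> 1" using r by (auto simp: d_def)
  have "\<exists>n. \<bar>\<tau>\<bar> \<le> pi * (2^n * d)"
  proof -
    obtain n where "\<bar>\<tau>\<bar> / (pi*d) < 2^n" using real_arch_pow[of 2] by auto
    thus ?thesis using d by (intro exI[of _ n]) (simp add: field_simps)
  qed
  define n where "n = (LEAST n. \<bar>\<tau>\<bar> \<le> pi * (2^n * d))"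
  have n: "\<bar>\<tau>\<bar> \<le> pi * (2^n * d)" unfolding n_def by (rule LeastI_ex) fact
  have below: "cmod (cis \<tau> - of_real r) \<ge> d"
    using norm_triangle_ineq2[of "cis \<tau>" "of_real r"] r by (auto simp: d_def)
  have "cmod (cis \<tau> - 1) \<le> cmod (cis \<tau> - of_real r) + cmod (of_real r - 1)"
    using norm_triangle_ineq[of "cis \<tau> - of_real r" "of_real r - 1"] by simp
  also have "cmod (of_real r - 1) = d"
    using norm_of_real[of "r - 1", where ?'a = complex] r by (simp add: d_def del: norm_of_real)
  \<comment> \<open>The cost \<open>d\<close> of moving from \<open>1\<close> to \<open>r\<close> is
    itself at most the distance to \<open>r\<close>, by \<open>below\<close>; hence half of the
    bound \<open>2 * |\<tau>| / pi\<close> survives.\<close>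
  finally have far: "\<bar>\<tau>\<bar> / pi \<le> cmod (cis \<tau> - of_real r)"
    using norm_cis_minus_1_ge[OF \<tau>] below by simp
  have num: "1 - r\<^sup>2 \<le> 2 * d"
  proof -
    have "2 * d - (1 - r\<^sup>2) = d\<^sup>2" by (simp add: d_def power2_eq_square algebra_simps)
    thus ?thesis using zero_le_power2[of d] by linarith
  qed
  have half: "2^n * d / 2 \<le> cmod (cis \<tau> - of_real r)"
  proof (cases n)
    case 0 thus ?thesis using below d by simp
  next
    case (Suc m)
    hence "\<not> \<bar>\<tau>\<bar> \<le> pi * (2^m * d)" using not_less_Least[of m "\<lambda>n. \<bar>\<tau>\<bar> \<le> pi * (2^n * d)"] n_def by auto
    hence "2^m * d \<le> \<bar>\<tau>\<bar> / pi" by (simp add: field_simps)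
    thus ?thesis using far Suc by simp
  qed
  have "(1 - r\<^sup>2) / (cmod (cis \<tau> - of_real r))\<^sup>2 \<le> (2 * d) / (2^n * d / 2)\<^sup>2"
    using num half d r by (intro frac_le power_mono) (auto simp: power_le_one)
  also have "\<dots> = 8 / (4^n * d)"
  proof -
    have "((2::real)^n)\<^sup>2 = 4^n" by (simp add: power_even_eq power2_eq_square flip: power_mult_distrib)
    thus ?thesis using d by (simp add: power2_eq_square field_simps)
  qed
  finally show ?thesis using n \<tau> by (intro exI[of _ n]) (auto simp: d_def min_def)
qed

text \<open>Each point of the period lies in some window on which the kernel is, at that point, at
  most \<open>8 / (4^n * (1 - r))\<close>; so the kernel is dominated by the weighted sum of window
  indicators, and only the masses of \<open>u\<close> on windows centred at \<open>\<theta>\<close>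
  matter. This serves both the maximal inequality and the final Poisson estimate.\<close>

lemma poisson_kernel_nn_integral:
  fixes u :: "real \<Rightarrow> ennreal" and A :: "nat \<Rightarrow> ennreal"
  assumes [measurable]: "u \<in> borel_measurable borel" and r: "0 \<le> r" "r < 1"
    and A: "\<And>n. (\<integral>\<^sup>+t\<in>{\<theta> - pi * min (2^n * (1 - r)) 1..\<theta> + pi * min (2^n * (1 - r)) 1}. u t \<partial>lborel) \<le> A n"
  shows "(\<integral>\<^sup>+t\<in>{\<theta> - pi..\<theta> + pi}. u t * ennreal ((1 - r\<^sup>2) / (cmod (cis (t - \<theta>) - of_real r))\<^sup>2) \<partial>lborel)
           \<le> (\<Sum>n. ennreal (8 / (4^n * (1 - r))) * A n)"
proof -
  define I where "I n = {\<theta> - pi * min (2^n * (1 - r)) 1..\<theta> + pi * min (2^n * (1 - r)) 1}" for n :: nat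
  have [measurable]: "I n \<in> sets borel" for n by (simp add: I_def)
  have "u t * ennreal ((1 - r\<^sup>2) / (cmod (cis (t - \<theta>) - of_real r))\<^sup>2) * indicator {\<theta> - pi..\<theta> + pi} t
          \<le> (\<Sum>n. ennreal (8 / (4^n * (1 - r))) * (u t * indicator (I n) t))" for t
  proof (cases "t \<in> {\<theta> - pi..\<theta> + pi}")
    case True
    then obtain n where n: "\<bar>t - \<theta>\<bar> \<le> pi * min (2^n * (1 - r)) 1"
      "(1 - r\<^sup>2) / (cmod (cis (t - \<theta>) - of_real r))\<^sup>2 \<le> 8 / (4^n * (1 - r))"
      using poisson_kernel_dyadic[OF r, of "t - \<theta>"] by (auto simp: abs_le_iff)
    have t: "t \<in> I n" using n(1) by (auto simp: I_def)
    have "u t * ennreal ((1 - r\<^sup>2) / (cmod (cis (t - \<theta>) - of_real r))\<^sup>2) \<le> ennreal (8 / (4^n * (1 - r))) * (u t * indicator (I n) t)"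
      using n(2) t by (simp add: mult.commute ennreal_leI mult_left_mono)
    also have "\<dots> \<le> (\<Sum>n. ennreal (8 / (4^n * (1 - r))) * (u t * indicator (I n) t))"
      using sum_le_suminf[of "\<lambda>n. ennreal (8 / (4^n * (1 - r))) * (u t * indicator (I n) t)" "{n}"] by simp
    finally show ?thesis using True by simp
  qed simp
  hence "(\<integral>\<^sup>+t\<in>{\<theta> - pi..\<theta> + pi}. u t * ennreal ((1 - r\<^sup>2) / (cmod (cis (t - \<theta>) - of_real r))\<^sup>2) \<partial>lborel)
      \<le> (\<integral>\<^sup>+t. (\<Sum>n. ennreal (8 / (4^n * (1 - r))) * (u t * indicator (I n) t)) \<partial>lborel)"
    by (intro nn_integral_mono) simp
  also have "\<dots> = (\<Sum>n. \<integral>\<^sup>+t. ennreal (8 / (4^n * (1 - r))) * (u t * indicator (I n) t) \<partial>lborel)"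
    by (rule nn_integral_suminf) measurable
  also have "\<dots> = (\<Sum>n. ennreal (8 / (4^n * (1 - r))) * (\<integral>\<^sup>+t\<in>I n. u t \<partial>lborel))"
    by (subst nn_integral_cmult) auto
  also have "\<dots> \<le> (\<Sum>n. ennreal (8 / (4^n * (1 - r))) * A n)"
    using A by (intro suminf_le mult_left_mono) (auto simp: I_def)
  finally show ?thesis .
qed

text \<open>The intervals of a Vitali subfamily are disjoint, so their masses add up to at most the
  total mass of \<open>u\<close>, while their fivefold enlargements cover \<open>E\<close>. The
  conclusion speaks of a Borel superset \<open>V\<close> because \<open>E\<close> is not assumed
  measurable.\<close>

lemma hardy_littlewood_covering:
  fixes u :: "real \<Rightarrow> ennreal" and E :: "real set"
  assumes [measurable]: "u \<in> borel_measurable borel"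
    and E: "\<And>x. x \<in> E \<Longrightarrow> \<exists>s. 0 < s \<and> s \<le> B \<and> c * ennreal (2 * s) \<le> (\<integral>\<^sup>+t\<in>{x - s..x + s}. u t \<partial>lborel)"
  shows "\<exists>V\<in>sets borel. E \<subseteq> V \<and> c * emeasure lborel V \<le> 5 * (\<integral>\<^sup>+t. u t \<partial>lborel)"
proof -
  obtain s where s: "\<And>x. x \<in> E \<Longrightarrow> 0 < s x \<and> s x \<le> B \<and> c * ennreal (2 * s x) \<le> (\<integral>\<^sup>+t\<in>{x - s x..x + s x}. u t \<partial>lborel)"
    using E by metis
  have "E \<subseteq> (\<Union>x\<in>E. cball x (s x))" using s by (force intro: less_imp_le)
  then obtain C where C: "countable C" "C \<subseteq> E"
      "pairwise (\<lambda>i j. disjnt (cball i (s i)) (cball j (s j))) C"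
      "E \<subseteq> (\<Union>i\<in>C. cball i (5 * s i))"
    by (rule Vitali_covering_lemma_cballs) (use s in blast)+
  define V where "V = (\<Union>i\<in>C. cball i (5 * s i))"
  have disj: "disjoint_family_on (\<lambda>i. cball i (s i)) C"
    using C(3) by (auto simp: disjoint_family_on_def pairwise_def disjnt_def)
  have V[measurable]: "V \<in> sets borel" unfolding V_def using C(1) by (intro sets.countable_UN') auto
  \<comment> \<open>Countable subadditivity over the index set \<open>C\<close> itself, written as
    an exchange of the Lebesgue integral with an integral against counting measure.\<close>
  have "emeasure lborel V \<le> (\<integral>\<^sup>+i. emeasure lborel (cball i (5 * s i)) \<partial>count_space C)"
  proof -
    have "indicator V x \<le> (\<integral>\<^sup>+i. indicator (cball i (5 * s i)) x \<partial>count_space C :: ennreal)" for x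
    proof (cases "x \<in> V")
      case True
      then obtain i where i: "i \<in> C" "x \<in> cball i (5 * s i)" by (auto simp: V_def)
      show ?thesis using i nn_integral_ge_point[of i C "\<lambda>i. indicator (cball i (5 * s i)) x"] True by simp
    qed simp
    hence "(\<integral>\<^sup>+x. indicator V x \<partial>lborel)
        \<le> (\<integral>\<^sup>+x. \<integral>\<^sup>+i. indicator (cball i (5 * s i)) x \<partial>count_space C \<partial>lborel)"
      by (intro nn_integral_mono)
    also have "\<dots> = (\<integral>\<^sup>+i. \<integral>\<^sup>+x. indicator (cball i (5 * s i)) x \<partial>lborel \<partial>count_space C)"
      by (rule nn_integral_count_space_nn_integral[OF C(1)]) (simp add: borel_measurable_indicator)
    finally show ?thesis by simp
  qed
  hence "c * emeasure lborel V \<le> (\<integral>\<^sup>+i. c * emeasure lborel (cball i (5 * s i)) \<partial>count_space C)"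
    by (subst nn_integral_cmult) (auto intro: mult_left_mono)
  also have "\<dots> \<le> (\<integral>\<^sup>+i. 5 * emeasure (density lborel u) (cball i (s i)) \<partial>count_space C)"
  proof (intro nn_integral_mono)
    fix i assume "i \<in> space (count_space C)"
    hence i: "i \<in> E" using C by auto
    have "emeasure lborel (cball i (5 * s i)) = 5 * ennreal (2 * s i)"
      using s[OF i] by (simp add: cball_eq_atLeastAtMost ennreal_mult[symmetric] flip: ennreal_numeral)
    hence "c * emeasure lborel (cball i (5 * s i)) = 5 * (c * ennreal (2 * s i))" by (simp add: mult_ac)
    also have "\<dots> \<le> 5 * (\<integral>\<^sup>+t\<in>{i - s i..i + s i}. u t \<partial>lborel)" using s[OF i] by (intro mult_left_mono) auto
    also have "\<dots> = 5 * emeasure (density lborel u) (cball i (s i))"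
      by (simp add: emeasure_density cball_eq_atLeastAtMost)
    finally show "c * emeasure lborel (cball i (5 * s i)) \<le> 5 * emeasure (density lborel u) (cball i (s i))" .
  qed
  \<comment> \<open>The measure \<open>density lborel u\<close> turns the sum of the masses of
    disjoint intervals into the mass of their union.\<close>
  also have "\<dots> = 5 * emeasure (density lborel u) (\<Union>i\<in>C. cball i (s i))"
    by (subst emeasure_UN_countable[OF _ C(1) disj]) (auto simp: nn_integral_cmult)
  also have "\<dots> \<le> 5 * emeasure (density lborel u) UNIV"
    by (intro mult_left_mono emeasure_mono) auto
  also have "\<dots> = 5 * (\<integral>\<^sup>+t. u t \<partial>lborel)" by (simp add: emeasure_density)
  finally show ?thesis using C(4) V by (intro bexI[of _ V]) (auto simp: V_def)
qed

text \<open>Cauchy's formula at \<open>-r\<close> for \<open>w \<mapsto> G w (1 - r\<^sup>2) / (1 + r w)\<close>, where \<open>G\<close> is \<open>F\<close> dilated and rotated;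
  the rotation by \<open>\<theta> + \<pi>\<close> centres the interval of integration at \<open>\<theta>\<close>.\<close>

lemma poisson_bound:
  assumes hol: "F holomorphic_on ball 0 1" and R: "0 < R" "R < 1" and r: "0 \<le> r" "r < 1"
  shows "cmod (F (of_real (R * r) * cis \<theta>)) \<le> 1 / (2*pi) *
     integral {\<theta> - pi..\<theta> + pi} (\<lambda>t. cmod (F (of_real R * cis t)) * ((1 - r\<^sup>2) / (cmod (cis (t - \<theta>) - of_real r))\<^sup>2))"
proof -
  define G where "G w = F (- of_real R * cis \<theta> * w)" for w
  define g where "g w = G w * of_real (1 - r\<^sup>2) / (1 + of_real r * w)" for w
  have maps: "- of_real R * cis \<theta> * w \<in> ball 0 1" if "cmod w \<le> 1" for w
  proof -
    have "R * cmod w \<le> R" using mult_left_le[of "cmod w" R] that R by simp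
    hence "R * cmod w < 1" using R(2) by (rule le_less_trans)
    thus ?thesis using R by (simp add: norm_mult)
  qed
  have nz: "1 + of_real r * w \<noteq> 0" if "cmod w \<le> 1" for w
  proof
    assume "1 + of_real r * w = 0"
    hence "of_real r * w = -1" by (simp add: add_eq_0_iff)
    hence "r * cmod w = 1" using r by (metis norm_mult norm_minus_cancel norm_one norm_of_real abs_of_nonneg)
    moreover have "r * cmod w \<le> r" using that r by (simp add: mult_left_le)
    ultimately show False using r by simp
  qed
  have Fc: "continuous_on (ball 0 1) F" using hol by (rule holomorphic_on_imp_continuous_on)
  have Gc: "continuous_on (cball 0 1) G" unfolding G_def
    by (rule continuous_on_compose2[OF Fc]) (use maps in \<open>auto intro!: continuous_intros\<close>)
  have Gh: "G holomorphic_on ball 0 1" unfolding G_def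
    by (rule holomorphic_on_compose_gen[OF _ hol, unfolded o_def]) (use maps in \<open>auto intro!: holomorphic_intros\<close>)
  have gc: "continuous_on (cball 0 1) g" unfolding g_def
    using nz by (auto intro!: continuous_intros Gc)
  have gh: "g holomorphic_on ball 0 1" unfolding g_def
    using nz by (auto intro!: holomorphic_intros Gh)
  have rb: "cmod (- of_real r - 0) < 1" using r by simp
  have r2: "r\<^sup>2 < 1" using r by (simp add: abs_square_less_1)
  have "g (- of_real r) = G (- of_real r)"
  proof -
    have "1 + of_real r * (- of_real r) = of_real (1 - r\<^sup>2)" "of_real (1 - r\<^sup>2) \<noteq> (0::complex)"
      using r2 by (auto simp: power2_eq_square simp flip: of_real_mult)
    thus ?thesis unfolding g_def by (metis nonzero_mult_div_cancel_right)
  qed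
  also have "\<dots> = F (of_real (R * r) * cis \<theta>)" by (simp add: G_def mult_ac)
  finally have gr: "g (- of_real r) = F (of_real (R * r) * cis \<theta>)" .
  have ci: "contour_integral (circlepath 0 1) (\<lambda>w. g w / (w + of_real r)) = 2 * pi * \<i> * F (of_real (R * r) * cis \<theta>)"
    using contour_integral_unique[OF Cauchy_integral_circlepath[OF gc gh rb]] gr by simp
  define k where "k t = G (cis t) * of_real ((1 - r\<^sup>2) / (cmod (cis t + of_real r))\<^sup>2)" for t
  \<comment> \<open>On the unit circle Cauchy's denominator \<open>w + r\<close> equals
    \<open>w\<close> times the conjugate of \<open>1 + r * w\<close>, the denominator of
    \<open>g\<close>. Their product is \<open>w\<close> times a square modulus, so the positive
    Poisson kernel appears and moduli can be taken inside the integral.\<close>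
  have k: "g (cis t) / (cis t + of_real r) * \<i> * cis t = \<i> * k t" for t
  proof -
    have "cis t + of_real r = cis t * (1 + of_real r * cis (-t))" by (simp add: algebra_simps cis_mult)
    moreover have "1 + of_real r * cis (-t) = cnj (1 + of_real r * cis t)" by (simp add: cis_cnj)
    ultimately have 1: "cis t + of_real r = cis t * cnj (1 + of_real r * cis t)" by simp
    hence 2: "cmod (cis t + of_real r) = cmod (1 + of_real r * cis t)" by (simp add: norm_mult del: complex_cnj_add)
    have nz1: "1 + of_real r * cis t \<noteq> 0" using nz[of "cis t"] by simp
    have "g (cis t) / (cis t + of_real r) * \<i> * cis t
       = \<i> * G (cis t) * of_real (1 - r\<^sup>2) / ((1 + of_real r * cis t) * cnj (1 + of_real r * cis t))"
    proof -
      have "x / a / (c * b) * \<i> * c = \<i> * x / (a * b)" if "c \<noteq> 0" for a b c x :: complex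
        using that by (simp add: field_simps)
      from this[OF cis_neq_zero] show ?thesis unfolding 1 g_def by (simp only: mult.assoc)
    qed
    also have "(1 + of_real r * cis t) * cnj (1 + of_real r * cis t) = of_real ((cmod (cis t + of_real r))\<^sup>2)"
      unfolding 2 by (rule complex_norm_square[symmetric])
    finally show ?thesis by (simp add: k_def)
  qed
  have kc: "continuous_on S k" for S
  proof -
    have nz': "(cmod (cis t + of_real r))\<^sup>2 \<noteq> 0" for t
    proof -
      have "r < cmod (cis t)" using r by simp
      hence "cis t + of_real r \<noteq> 0" by (metis norm_minus_cancel norm_of_real abs_of_nonneg r(1) add_eq_0_iff less_irrefl)
      thus ?thesis by simp
    qed
    have "continuous_on UNIV (\<lambda>t. G (cis t))"
      by (rule continuous_on_compose2[OF Gc]) (auto intro!: continuous_intros)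
    hence "continuous_on UNIV k" unfolding k_def using nz'
      by (intro continuous_intros) auto
    thus ?thesis by (rule continuous_on_subset) simp
  qed
  have "\<i> * integral {0..2*pi} k = 2 * pi * \<i> * F (of_real (R * r) * cis \<theta>)"
  proof -
    have "integral {0..2*pi} (\<lambda>t. \<i> * k t) = 2 * pi * \<i> * F (of_real (R * r) * cis \<theta>)"
      using ci contour_integral_part_circlepath_eq[of 0 "2*pi" 0 1 "\<lambda>w. g w / (w + of_real r)"]
      unfolding circlepath_def k[symmetric] by simp
    thus ?thesis by simp
  qed
  hence "cmod (\<i> * integral {0..2*pi} k) = cmod (2 * pi * \<i> * F (of_real (R * r) * cis \<theta>))" by (rule arg_cong)
  hence "cmod (integral {0..2*pi} k) = 2 * pi * cmod (F (of_real (R * r) * cis \<theta>))"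
    by (simp add: norm_mult)
  moreover have "cmod (integral {0..2*pi} k) \<le> integral {0..2*pi} (\<lambda>t. cmod (k t))"
    by (intro integral_norm_bound_integral integrable_continuous_real continuous_intros kc) auto
  moreover have "integral {0..2*pi} (\<lambda>t. cmod (k t)) = integral {\<theta> - pi..\<theta> + pi} (\<lambda>t. cmod (k (t - \<theta> + pi)))"
  proof -
    have "((\<lambda>t. cmod (k t)) has_integral integral {0..2*pi} (\<lambda>t. cmod (k t))) (cbox 0 (2*pi))"
      by (auto intro!: integrable_integral integrable_continuous_real continuous_intros kc)
    moreover have "(\<lambda>x. x + \<theta> - pi) ` {0..pi * 2} = {\<theta> - pi..pi + \<theta>}"
    proof -
      have "(\<lambda>x. x + \<theta> - pi) ` {0..pi * 2} = (+) (\<theta> - pi) ` {0..pi * 2}" by (intro image_cong) auto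
      also have "\<dots> = {\<theta> - pi..pi + \<theta>}" by (subst image_add_atLeastAtMost) simp
      finally show ?thesis .
    qed
    ultimately show ?thesis using has_integral_affinity[of _ _ 0 "2*pi" 1 "pi - \<theta>"]
      by (intro integral_unique[symmetric]) (force simp: algebra_simps)
  qed
  moreover have "cmod (k (t - \<theta> + pi)) = cmod (F (of_real R * cis t)) * ((1 - r\<^sup>2) / (cmod (cis (t - \<theta>) - of_real r))\<^sup>2)" for t
  proof -
    have c: "cis (t - \<theta> + pi) = - cis (t - \<theta>)" using cis_mult[of "t - \<theta>" pi] by simp
    have "cmod (- cis (t - \<theta>) + of_real r) = cmod (cis (t - \<theta>) - of_real r)"
      by (metis add.commute uminus_add_conv_diff norm_minus_commute)
    moreover have "G (- cis (t - \<theta>)) = F (of_real R * cis t)" by (simp add: G_def mult.assoc cis_mult)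
    ultimately show ?thesis unfolding k_def c using r2 by (simp add: norm_mult norm_divide norm_power del: of_real_diff of_real_power) 
  qed
  ultimately show ?thesis by (simp add: field_simps)
qed

text \<open>If all windows around \<open>\<theta>\<close> had averages at most
  \<open>\<alpha> / 16\<close>, the dyadic Poisson sum would keep \<open>cmod F\<close> at most
  \<open>\<alpha>\<close> on the radius. So each point of the set has a window with a large average,
  and the covering lemma bounds the measure with \<open>5 * 16 = 80\<close>. The interval from
  \<open>-pi\<close> to \<open>3*pi\<close> contains every window of half-width at most
  \<open>pi\<close> around a point of \<open>{0..2*pi}\<close>.\<close>

lemma weak_type_radial_maximal:
  fixes F :: "complex \<Rightarrow> complex" and I \<alpha> :: real
  assumes hol: "F holomorphic_on ball 0 1"
    and I: "\<And>R. 0 < R \<Longrightarrow> R < 1 \<Longrightarrow> integral {-pi..3*pi} (\<lambda>t. cmod (F (of_real R * cis t))) \<le> I"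
    and \<alpha>: "\<alpha> > 0"
  defines "E \<equiv> {\<theta>\<in>{0..2*pi}. \<exists>r\<in>{0..<1}. cmod (F (of_real r * cis \<theta>)) > \<alpha>}"
  shows "E \<in> sets borel" "emeasure lborel E \<le> ennreal (80 * I / \<alpha>)"
proof -
  \<comment> \<open>The set for the dilated function \<open>F (R * z)\<close>, whose values on radii
    are controlled by the circle of radius \<open>R\<close>. \<open>E\<close> is the increasing
    union of these sets as \<open>R\<close> tends to 1.\<close>
  define D where "D R = {\<theta>\<in>{0..2*pi}. \<exists>r\<in>{0..<1}. cmod (F (of_real (R * r) * cis \<theta>)) > \<alpha>}" for R
  have Fc: "continuous_on (ball 0 1) F" using hol by (rule holomorphic_on_imp_continuous_on)
  have cont: "continuous_on S (\<lambda>t. F (of_real s * cis t))" if "0 \<le> s" "s < 1" for s S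
    by (rule continuous_on_compose2[OF Fc]) (use that in \<open>auto intro!: continuous_intros simp: norm_mult\<close>)
  have prod: "0 \<le> R * r" "R * r < 1" if "0 < R" "R < 1" "0 \<le> r" "r < 1" for R r :: real
    using that mult_strict_mono'[of R 1 r 1] by auto
  have D_sets: "D R \<in> sets borel" if "0 < R" "R < 1" for R
  proof -
    have "open {\<theta>. \<alpha> < cmod (F (of_real (R * r) * cis \<theta>))}" if "r \<in> {0..<1}" for r
      using prod[OF \<open>0 < R\<close> \<open>R < 1\<close>, of r] that
      by (intro open_Collect_less continuous_intros cont) auto
    hence "open (\<Union>r\<in>{0..<1}. {\<theta>. \<alpha> < cmod (F (of_real (R * r) * cis \<theta>))})" by blast
    moreover have "D R = {0..2*pi} \<inter> (\<Union>r\<in>{0..<1}. {\<theta>. \<alpha> < cmod (F (of_real (R * r) * cis \<theta>))})"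
      by (auto simp: D_def)
    ultimately show ?thesis by simp
  qed
  have D_le: "emeasure lborel (D R) \<le> ennreal (80 * I / \<alpha>)" if R: "0 < R" "R < 1" for R
  proof -
    define v where "v t = cmod (F (of_real R * cis t))" for t
    define u where "u t = ennreal (v t) * indicator {-pi..3*pi} t" for t
    have vc: "continuous_on S v" for S unfolding v_def using R by (intro continuous_intros cont) auto
    have [measurable]: "v \<in> borel_measurable borel" using vc by (rule borel_measurable_continuous_onI)
    have um[measurable]: "u \<in> borel_measurable borel" unfolding u_def by measurable
    have "\<exists>s. 0 < s \<and> s \<le> pi \<and> ennreal (\<alpha>/16) * ennreal (2 * s) \<le> (\<integral>\<^sup>+t\<in>{\<theta> - s..\<theta> + s}. u t \<partial>lborel)"
      if "\<theta> \<in> D R" for \<theta>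
    proof (rule ccontr)
      assume "\<not> ?thesis"
      hence small: "(\<integral>\<^sup>+t\<in>{\<theta> - s..\<theta> + s}. u t \<partial>lborel) \<le> ennreal (\<alpha>/16) * ennreal (2 * s)"
        if "0 < s" "s \<le> pi" for s using that by (meson linear)
      obtain r where r: "0 \<le> r" "r < 1" "\<alpha> < cmod (F (of_real (R * r) * cis \<theta>))"
        and \<theta>: "0 \<le> \<theta>" "\<theta> \<le> 2*pi" using \<open>\<theta> \<in> D R\<close> by (auto simp: D_def)
      define P where "P t = (1 - r\<^sup>2) / (cmod (cis (t - \<theta>) - of_real r))\<^sup>2" for t
      have P0: "P t \<ge> 0" for t using r by (simp add: P_def power_le_one)
      have Pc: "continuous_on {\<theta> - pi..\<theta> + pi} P" unfolding P_def
      proof (intro continuous_intros ballI)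
        fix t
        have "r < cmod (cis (t - \<theta>))" using r by simp
        hence "cis (t - \<theta>) \<noteq> of_real r" by (metis norm_of_real abs_of_nonneg r(1) less_irrefl)
        thus "(cmod (cis (t - \<theta>) - of_real r))\<^sup>2 \<noteq> 0" by simp
      qed
      have "ennreal (2 * pi * cmod (F (of_real (R * r) * cis \<theta>))) \<le> ennreal (integral {\<theta> - pi..\<theta> + pi} (\<lambda>t. v t * P t))"
        using poisson_bound[OF hol R r(1,2), of \<theta>]
        by (intro ennreal_leI) (simp add: v_def P_def field_simps)
      also have "\<dots> = (\<integral>\<^sup>+t\<in>{\<theta> - pi..\<theta> + pi}. ennreal (v t * P t) \<partial>lborel)"
        by (rule nn_integral_Icc_continuous[symmetric]) (use P0 in \<open>auto intro!: continuous_on_mult vc Pc mult_nonneg_nonneg, simp add: v_def\<close>)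
      also have "\<dots> = (\<integral>\<^sup>+t\<in>{\<theta> - pi..\<theta> + pi}. u t * ennreal (P t) \<partial>lborel)"
        using \<theta> by (intro nn_integral_cong) (auto simp: u_def indicator_def ennreal_mult'' P0)
      also have "\<dots> \<le> (\<Sum>n. ennreal (8 / (4^n * (1 - r))) * (ennreal (\<alpha>/16) * ennreal (2 * (pi * min (2^n * (1 - r)) 1))))"
        unfolding P_def
      proof (rule poisson_kernel_nn_integral[OF um r(1,2)])
        fix n :: nat
        show "(\<integral>\<^sup>+t\<in>{\<theta> - pi * min (2^n * (1 - r)) 1..\<theta> + pi * min (2^n * (1 - r)) 1}. u t \<partial>lborel)
           \<le> ennreal (\<alpha>/16) * ennreal (2 * (pi * min (2^n * (1 - r)) 1))"
          by (rule small) (use r in \<open>auto simp: mult_left_le\<close>)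
      qed
      \<comment> \<open>The n-th term is at most \<open>pi * \<alpha> / 2^n\<close>. The choice of
        \<open>\<alpha> / 16\<close> makes these sum to exactly \<open>2 * pi * \<alpha>\<close>,
        against \<open>r(3)\<close>.\<close>
      also have "\<dots> \<le> (\<Sum>n. ennreal (2 * pi * \<alpha> * (1/2)^Suc n))"
      proof (intro suminf_le)
        fix n :: nat
        have "8 / (4^n * (1 - r)) * (\<alpha>/16 * (2 * (pi * min (2^n * (1 - r)) 1)))
          \<le> 8 / (4^n * (1 - r)) * (\<alpha>/16 * (2 * (pi * (2^n * (1 - r)))))"
          using r \<alpha> by (intro mult_left_mono) auto
        also have "\<dots> = 2 * pi * \<alpha> * (1/2)^Suc n"
        proof -
          have "(4::real)^n = 2^n * 2^n" by (simp flip: power_mult_distrib)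
          thus ?thesis using r by (simp add: field_simps)
        qed
        finally show "ennreal (8 / (4^n * (1 - r))) * (ennreal (\<alpha>/16) * ennreal (2 * (pi * min (2^n * (1 - r)) 1)))
          \<le> ennreal (2 * pi * \<alpha> * (1/2)^Suc n)"
          using r \<alpha> by (simp add: ennreal_mult[symmetric] ennreal_leI)
      qed auto
      also have "\<dots> = ennreal (2 * pi * \<alpha>)"
        using sums_mult[OF power_half_series, of "2 * pi * \<alpha>"] \<alpha> by (intro suminf_ennreal_eq) auto
      finally show False using r(3) \<alpha> by (simp add: ennreal_le_iff)
    qed
    hence "\<exists>V\<in>sets borel. D R \<subseteq> V \<and>
        ennreal (\<alpha>/16) * emeasure lborel V \<le> 5 * (\<integral>\<^sup>+t. u t \<partial>lborel)"
      by (rule hardy_littlewood_covering[OF um])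
    then obtain V where V: "V \<in> sets borel" "D R \<subseteq> V"
        "ennreal (\<alpha>/16) * emeasure lborel V \<le> 5 * (\<integral>\<^sup>+t. u t \<partial>lborel)" by blast
    have "(\<integral>\<^sup>+t. u t \<partial>lborel) = ennreal (integral {-pi..3*pi} v)"
      unfolding u_def by (rule nn_integral_Icc_continuous[OF vc]) (simp add: v_def)
    also have "\<dots> \<le> ennreal I" using I[OF R] by (intro ennreal_leI) (simp add: v_def[abs_def])
    finally have "5 * (\<integral>\<^sup>+t. u t \<partial>lborel) \<le> 5 * ennreal I" by (intro mult_left_mono) auto
    moreover have "emeasure lborel (D R) \<le> emeasure lborel V" using V by (intro emeasure_mono) auto
    hence "ennreal (\<alpha>/16) * emeasure lborel (D R) \<le> ennreal (\<alpha>/16) * emeasure lborel V"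
      by (intro mult_left_mono) auto
    ultimately have "ennreal (\<alpha>/16) * emeasure lborel (D R) \<le> 5 * ennreal I" using V(3) by simp
    hence "ennreal (16/\<alpha>) * (ennreal (\<alpha>/16) * emeasure lborel (D R)) \<le> ennreal (16/\<alpha>) * (5 * ennreal I)"
      by (intro mult_left_mono) auto
    moreover have "ennreal (16/\<alpha>) * (ennreal (\<alpha>/16) * x) = x" for x
      using \<alpha> by (simp add: mult.assoc[symmetric] ennreal_mult[symmetric])
    moreover have "ennreal (16/\<alpha>) * (5 * ennreal I) = ennreal (80 * I / \<alpha>)"
    proof -
      have "5 * ennreal I = ennreal (5 * I)" by (subst ennreal_mult') auto
      hence "ennreal (16/\<alpha>) * (5 * ennreal I) = ennreal (16/\<alpha> * (5 * I))"
        using \<alpha> ennreal_mult'[of "16/\<alpha>" "5 * I"] by simp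
      also have "16/\<alpha> * (5 * I) = 80 * I / \<alpha>" by simp
      finally show ?thesis .
    qed
    ultimately show ?thesis by simp
  qed
  define \<rho> where "\<rho> k = 1 - 1 / (real k + 2)" for k
  have \<rho>: "0 < \<rho> k" "\<rho> k < 1" for k by (auto simp: \<rho>_def field_simps)
  have scale: "x \<in> D R" if "x \<in> {0..2*pi}" "0 \<le> s" "s < R" "\<alpha> < cmod (F (of_real s * cis x))" for x s R
    unfolding D_def using that by (auto intro!: bexI[of _ "s / R"] simp del: of_real_mult)
  have "incseq (\<lambda>k. D (\<rho> k))"
  proof (rule incseq_SucI, rule subsetI)
    fix k x assume "x \<in> D (\<rho> k)"
    then obtain r where r: "r \<in> {0..<1}" "\<alpha> < cmod (F (of_real (\<rho> k * r) * cis x))" "x \<in> {0..2*pi}"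
      by (auto simp: D_def)
    have "\<rho> k * r \<le> \<rho> k" using r \<rho>[of k] by (simp add: mult_left_le)
    also have "\<rho> k < \<rho> (Suc k)" by (simp add: \<rho>_def field_simps)
    finally show "x \<in> D (\<rho> (Suc k))" using r prod[OF \<rho>, of r k] by (intro scale[where s="\<rho> k * r"]) auto
  qed
  moreover have E: "E = (\<Union>k. D (\<rho> k))"
  proof (intro equalityI subsetI)
    fix x assume "x \<in> E"
    then obtain r where r: "0 \<le> r" "r < 1" "\<alpha> < cmod (F (of_real r * cis x))" "x \<in> {0..2*pi}" by (auto simp: E_def)
    obtain k where "1 / (1 - r) < real k" using reals_Archimedean2 by blast
    hence "r < \<rho> k" using r by (simp add: \<rho>_def field_simps)
    with r show "x \<in> (\<Union>k. D (\<rho> k))" by (auto intro!: scale[where s=r])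
  next
    fix x assume "x \<in> (\<Union>k. D (\<rho> k))"
    then obtain k r where "r \<in> {0..<1}" "\<alpha> < cmod (F (of_real (\<rho> k * r) * cis x))" "x \<in> {0..2*pi}"
      by (auto simp: D_def)
    thus "x \<in> E" unfolding E_def using prod[OF \<rho>, of r k]
      by (auto intro!: bexI[of _ "\<rho> k * r"] simp del: of_real_mult)
  qed
  ultimately have "emeasure lborel E = (SUP k. emeasure lborel (D (\<rho> k)))"
    using D_sets[OF \<rho>] by (subst SUP_emeasure_incseq) auto
  thus "emeasure lborel E \<le> ennreal (80 * I / \<alpha>)" using D_le[OF \<rho>] by (auto intro: SUP_least)
  show "E \<in> sets borel" unfolding E using D_sets[OF \<rho>] by auto
qed

section \<open>Radial limits of \<open>H\<^sup>2\<close> functions\<close>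

lemma has_integral_cis_int:
  assumes "k \<noteq> (0::int)"
  shows "((\<lambda>t. cis (of_int k * t)) has_integral 0) {-pi..3*pi}"
proof -
  have "((\<lambda>t. cis (of_int k * t) / (\<i> * of_int k)) has_vector_derivative cis (of_int k * t)) (at t within {-pi..3*pi})" for t
  proof -
    have "((\<lambda>t. cis (of_int k * t)) has_vector_derivative (of_int k *\<^sub>R (\<i> * cis (of_int k * t)))) (at t within {-pi..3*pi})"
      unfolding has_vector_derivative_def by (auto intro!: derivative_eq_intros simp: mult.commute)
    from has_vector_derivative_divide[OF this, of "\<i> * of_int k"] show ?thesis
      using assms by (simp add: scaleR_conv_of_real)
  qed
  hence "((\<lambda>t. cis (of_int k * t)) has_integral (cis (of_int k * (3*pi)) / (\<i> * of_int k) - cis (of_int k * (-pi)) / (\<i> * of_int k))) {-pi..3*pi}"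
    by (intro fundamental_theorem_of_calculus) auto
  moreover have "cis (of_int k * (3*pi)) = cis (of_int k * (-pi)) * cis (2 * pi * of_int (2*k))"
    by (simp add: cis_mult algebra_simps)
  hence "cis (of_int k * (3*pi)) = cis (of_int k * (-pi))" using cis_multiple_2pi[of "of_int (2*k)"] by simp
  ultimately show ?thesis by simp
qed

text \<open>The terms of the power series are orthogonal over whole periods, so each new term adds
  its squared modulus to the mean square of the partial sums. Absolute convergence on the circle of
  radius \<open>R\<close> gives a constant majorant for dominated convergence. The factor
  \<open>1 / (4*pi)\<close> belongs to an interval of two periods, that of the maximal
  inequality.\<close>

lemma parseval_disc:
  assumes T: "\<And>z. cmod z < 1 \<Longrightarrow> (\<lambda>n. b n * z^n) sums T z" and R: "0 < R" "R < 1"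
  shows "(\<lambda>n. (cmod (b n))\<^sup>2 * R^(2*n)) sums
           (1 / (4*pi) * integral {-pi..3*pi} (\<lambda>t. (cmod (T (of_real R * cis t)))\<^sup>2))"
proof -
  define c where "c n = b n * of_real R^n" for n
  define S where "S N t = (\<Sum>n<N. c n * cis (of_int (int n) * t))" for N t
  have trm: "c n * cis (of_int (int n) * t) = b n * (of_real R * cis t)^n" for n t
    by (simp add: c_def power_mult_distrib Complex.DeMoivre)
  have csum: "summable (\<lambda>n. cmod (c n))"
    unfolding c_def
  proof -
    obtain x where x: "R < x" "x < 1" using dense[OF R(2)] by blast
    show "summable (\<lambda>n. cmod (b n * of_real R^n))"
    proof (rule powser_insidea)
      show "cmod (of_real R) < cmod (of_real x)" using x R by simp
      show "summable (\<lambda>n. b n * of_real x^n)" using T[of "of_real x"] x R by (simp add: sums_iff)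
    qed
  qed
  have Sc: "continuous_on X (S N)" for X N unfolding S_def by (intro continuous_intros)
  have I: "((\<lambda>t. (cmod (S N t))\<^sup>2) has_integral (4*pi * (\<Sum>n<N. (cmod (c n))\<^sup>2))) {-pi..3*pi}" for N
  proof (induction N)
    case 0 show ?case by (simp add: S_def)
  next
    case (Suc N)
    \<comment> \<open>The cross terms have frequency \<open>n - N\<close>, which is nonzero for
      \<open>n < N\<close>, and integrate to zero.\<close>
    have "((\<lambda>t. \<Sum>n<N. c n * cnj (c N) * cis (of_int (int n - int N) * t)) has_integral (\<Sum>n<N. c n * cnj (c N) * 0)) {-pi..3*pi}"
      by (intro has_integral_sum has_integral_mult_right has_integral_cis_int) auto
    from has_integral_linear[OF this bounded_linear_Re]
    have "((\<lambda>t. Re (\<Sum>n<N. c n * cnj (c N) * cis (of_int (int n - int N) * t))) has_integral 0) {-pi..3*pi}"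
      unfolding o_def by simp
    moreover have "(\<Sum>n<N. c n * cnj (c N) * cis (of_int (int n - int N) * t)) = S N t * cnj (c N * cis (of_int (int N) * t))" for t
    proof -
      have "cis (of_int (int n - int N) * t) = cis (of_int (int n) * t) * cnj (cis (of_int (int N) * t))" for n
        by (simp add: cis_cnj cis_mult algebra_simps)
      thus ?thesis by (simp add: S_def sum_distrib_right sum_distrib_left mult_ac)
    qed
    ultimately have "((\<lambda>t. Re (S N t * cnj (c N * cis (of_int (int N) * t)))) has_integral 0) {-pi..3*pi}" by (simp only:)
    hence "((\<lambda>t. (cmod (S N t))\<^sup>2 + (cmod (c N))\<^sup>2 + 2 * Re (S N t * cnj (c N * cis (of_int (int N) * t))))
      has_integral (4*pi * (\<Sum>n<N. (cmod (c n))\<^sup>2) + (3*pi - (-pi)) *\<^sub>R (cmod (c N))\<^sup>2 + 2 * 0)) {-pi..3*pi}"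
      by (intro has_integral_add Suc has_integral_mult_right has_integral_const_real[unfolded measure_lborel_Icc] ) 
         (use has_integral_const_real[of "(cmod (c N))\<^sup>2" "-pi" "3*pi"] in auto)
    moreover have "(cmod (S (Suc N) t))\<^sup>2 = (cmod (S N t))\<^sup>2 + (cmod (c N))\<^sup>2 + 2 * Re (S N t * cnj (c N * cis (of_int (int N) * t)))" for t
    proof -
      have "(cmod (x + y))\<^sup>2 = (cmod x)\<^sup>2 + (cmod y)\<^sup>2 + 2 * Re (x * cnj y)" for x y
        unfolding cmod_power2 by (simp add: power2_eq_square algebra_simps)
      from this[of "S N t" "c N * cis (of_int (int N) * t)"] show ?thesis by (simp add: S_def norm_mult)
    qed
    moreover have "4*pi * (\<Sum>n<N. (cmod (c n))\<^sup>2) + (3*pi - (-pi)) *\<^sub>R (cmod (c N))\<^sup>2 + 2 * 0 = 4*pi * (\<Sum>n<Suc N. (cmod (c n))\<^sup>2)"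
      by (simp add: algebra_simps)
    ultimately show ?case by (simp only:)
  qed
  have lim: "(\<lambda>N. S N t) \<longlonglongrightarrow> T (of_real R * cis t)" for t
    using T[of "of_real R * cis t"] R unfolding S_def trm sums_def by (simp add: norm_mult)
  have "(\<lambda>N. integral {-pi..3*pi} (\<lambda>t. (cmod (S N t))\<^sup>2)) \<longlonglongrightarrow> integral {-pi..3*pi} (\<lambda>t. (cmod (T (of_real R * cis t)))\<^sup>2)"
  proof (rule dominated_convergence(2)[where h="\<lambda>_. (\<Sum>n. cmod (c n))\<^sup>2"])
    show "norm ((cmod (S N t))\<^sup>2) \<le> (\<Sum>n. cmod (c n))\<^sup>2" for N t
    proof -
      have "cmod (S N t) \<le> (\<Sum>n<N. cmod (c n))"
        unfolding S_def by (rule order_trans[OF norm_sum]) (simp add: norm_mult)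
      also have "\<dots> \<le> (\<Sum>n. cmod (c n))" by (rule sum_le_suminf[OF csum]) auto
      finally show ?thesis by (simp add: power_mono)
    qed
  qed (use I lim in \<open>auto intro!: tendsto_intros\<close>)
  moreover have "integral {-pi..3*pi} (\<lambda>t. (cmod (S N t))\<^sup>2) = 4*pi * (\<Sum>n<N. (cmod (c n))\<^sup>2)" for N
    using I by (rule integral_unique)
  ultimately have "(\<lambda>N. 1/(4*pi) * (4*pi * (\<Sum>n<N. (cmod (c n))\<^sup>2))) \<longlonglongrightarrow>
     1/(4*pi) * integral {-pi..3*pi} (\<lambda>t. (cmod (T (of_real R * cis t)))\<^sup>2)"
    by (intro tendsto_mult tendsto_const) simp
  moreover have "(cmod (c n))\<^sup>2 = (cmod (b n))\<^sup>2 * R^(2*n)" for n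
    using R by (simp add: c_def norm_mult norm_power power_mult_distrib power_mult[symmetric] mult.commute)
  ultimately show ?thesis by (simp add: sums_def)
qed

text \<open>\<open>F\<close> is a polynomial \<open>P N\<close> plus a tail \<open>T N\<close> that
  is small in mean square for large \<open>N\<close>. The maximal inequality is applied to the
  square of \<open>T N\<close>, a holomorphic function whose modulus has small mean. Hence off a
  null set, for every tolerance, the tail for some \<open>N\<close> is small on the whole radius,
  while the polynomial is continuous at its end.\<close>

lemma H2_radial_limit:
  assumes hol: "F holomorphic_on ball 0 1"
    and I: "\<And>R. 0 < R \<Longrightarrow> R < 1 \<Longrightarrow> integral {-pi..3*pi} (\<lambda>t. (cmod (F (of_real R * cis t)))\<^sup>2) \<le> I"
  shows "AE \<theta> in lborel. \<theta> \<in> {0..2*pi} \<longrightarrow> (\<exists>L. ((\<lambda>r. F (of_real r * cis \<theta>)) \<longlongrightarrow> L) (at_left 1))"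
proof -
  define b where "b n = (deriv ^^ n) F 0 / fact n" for n
  have F: "(\<lambda>n. b n * z^n) sums F z" if "cmod z < 1" for z
    using holomorphic_power_series[OF hol, of z] that by (simp add: b_def)
  \<comment> \<open>Parseval's identity at radius \<open>R\<close>, cut off to finitely many terms;
    then \<open>R\<close> tends to 1.\<close>
  have psum: "(\<Sum>n<N. (cmod (b n))\<^sup>2) \<le> I / (4*pi)" for N
  proof (rule tendsto_upperbound)
    show "((\<lambda>R. \<Sum>n<N. (cmod (b n))\<^sup>2 * R^(2*n)) \<longlongrightarrow> (\<Sum>n<N. (cmod (b n))\<^sup>2)) (at_left (1::real))"
      by (auto intro!: tendsto_eq_intros)
    have "eventually (\<lambda>R. R \<in> {0<..<1}) (at_left (1::real))"
      by (rule eventually_at_leftI[of 0]) auto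
    thus "eventually (\<lambda>R. (\<Sum>n<N. (cmod (b n))\<^sup>2 * R^(2*n)) \<le> I / (4*pi)) (at_left 1)"
    proof eventually_elim
      case (elim R)
      have s: "(\<lambda>n. (cmod (b n))\<^sup>2 * R^(2*n)) sums
           (1 / (4*pi) * integral {-pi..3*pi} (\<lambda>t. (cmod (F (of_real R * cis t)))\<^sup>2))"
        using elim by (intro parseval_disc F) auto
      have "(\<Sum>n<N. (cmod (b n))\<^sup>2 * R^(2*n)) \<le> 1 / (4*pi) * integral {-pi..3*pi} (\<lambda>t. (cmod (F (of_real R * cis t)))\<^sup>2)"
        unfolding sums_unique[OF s] using elim s by (intro sum_le_suminf) (auto simp: sums_iff)
      also have "\<dots> \<le> 1 / (4*pi) * I" using I[of R] elim by (intro mult_left_mono) auto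
      finally show ?case by simp
    qed
  qed auto
  have bsum: "summable (\<lambda>n. (cmod (b n))\<^sup>2)" by (rule summableI_nonneg_bounded[OF _ psum]) auto
  define \<tau> where "\<tau> N = (\<Sum>n. (cmod (b n))\<^sup>2) - (\<Sum>n<N. (cmod (b n))\<^sup>2)" for N
  have "\<tau> \<longlonglongrightarrow> (\<Sum>n. (cmod (b n))\<^sup>2) - (\<Sum>n. (cmod (b n))\<^sup>2)"
    unfolding \<tau>_def by (intro tendsto_diff tendsto_const summable_LIMSEQ bsum)
  hence \<tau>: "\<tau> \<longlonglongrightarrow> 0" by simp
  define P where "P N z = (\<Sum>n<N. b n * z^n)" for N z
  define T where "T N z = F z - P N z" for N z
  have Thol: "T N holomorphic_on ball 0 1" for N
    unfolding T_def P_def by (intro holomorphic_intros hol)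
  have Tint: "integral {-pi..3*pi} (\<lambda>t. cmod ((T N (of_real R * cis t))\<^sup>2)) \<le> 4*pi * \<tau> N"
    if R: "0 < R" "R < 1" for N R
  proof -
    define c where "c n = (if n < N then 0 else b n)" for n
    have "(\<lambda>n. c n * z^n) sums T N z" if "cmod z < 1" for z
    proof -
      have "(\<lambda>n. b n * z^n - (if n \<in> {..<N} then b n * z^n else 0)) sums (F z - P N z)"
        unfolding P_def by (intro sums_diff F that sums_If_finite_set) auto
      moreover have "b n * z^n - (if n \<in> {..<N} then b n * z^n else 0) = c n * z^n" for n by (simp add: c_def)
      ultimately show ?thesis by (simp add: T_def)
    qed
    from parseval_disc[OF this R]
    have s: "(\<lambda>n. (cmod (c n))\<^sup>2 * R^(2*n)) sums (1 / (4*pi) * integral {-pi..3*pi} (\<lambda>t. (cmod (T N (of_real R * cis t)))\<^sup>2))" .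
    have "(\<lambda>n. (cmod (b n))\<^sup>2 - (if n \<in> {..<N} then (cmod (b n))\<^sup>2 else 0)) sums \<tau> N"
      unfolding \<tau>_def by (intro sums_diff summable_sums bsum sums_If_finite_set) auto
    moreover have "(cmod (b n))\<^sup>2 - (if n \<in> {..<N} then (cmod (b n))\<^sup>2 else 0) = (cmod (c n))\<^sup>2" for n
      by (simp add: c_def)
    ultimately have "(\<lambda>n. (cmod (c n))\<^sup>2) sums \<tau> N" by simp
    from sums_le[OF _ s this] have "1 / (4*pi) * integral {-pi..3*pi} (\<lambda>t. (cmod (T N (of_real R * cis t)))\<^sup>2) \<le> \<tau> N"
      using R by (simp add: mult_left_le power_le_one)
    thus ?thesis by (simp add: field_simps norm_power)
  qed
  define E where "E N m = {\<theta>\<in>{0..2*pi}. \<exists>r\<in>{0..<1}. cmod ((T N (of_real r * cis \<theta>))\<^sup>2) > (1/(real m + 1))\<^sup>2}" for N m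
  have E: "E N m \<in> sets borel" "emeasure lborel (E N m) \<le> ennreal (80 * (4*pi * \<tau> N) / (1/(real m + 1))\<^sup>2)" for N m
  proof -
    have h: "(\<lambda>z. (T N z)\<^sup>2) holomorphic_on ball 0 1" by (intro holomorphic_intros Thol)
    have p: "0 < (1/(real m + 1))\<^sup>2" by simp
    show "E N m \<in> sets borel" "emeasure lborel (E N m) \<le> ennreal (80 * (4*pi * \<tau> N) / (1/(real m + 1))\<^sup>2)"
      unfolding E_def using weak_type_radial_maximal[OF h Tint p] by blast+
  qed
  \<comment> \<open>For fixed \<open>m\<close> the measure of \<open>E N m\<close> is at most a
    constant times \<open>\<tau> N\<close>, so the intersection over \<open>N\<close> is null. One
    good \<open>N\<close> for each tolerance \<open>1 / (m + 1)\<close> is all that the Cauchy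
    criterion asks for.\<close>
  have null: "(\<Inter>N. E N m) \<in> null_sets lborel" for m
  proof (rule null_setsI)
    have "(\<lambda>N. ennreal (80 * (4*pi * \<tau> N) / (1/(real m + 1))\<^sup>2)) \<longlonglongrightarrow> ennreal (80 * (4*pi * 0) / (1/(real m + 1))\<^sup>2)"
      by (intro tendsto_ennrealI tendsto_intros \<tau>) auto
    moreover have "emeasure lborel (\<Inter>N. E N m) \<le> ennreal (80 * (4*pi * \<tau> N) / (1/(real m + 1))\<^sup>2)" for N
      by (rule order_trans[OF emeasure_mono E(2)]) (use E(1) in auto)
    ultimately have "emeasure lborel (\<Inter>N. E N m) \<le> ennreal (80 * (4*pi * 0) / (1/(real m + 1))\<^sup>2)"
      by (intro tendsto_lowerbound) auto
    thus "emeasure lborel (\<Inter>N. E N m) = 0" by simp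
  qed (use E(1) in auto)
  have "(\<Union>m. \<Inter>N. E N m) \<in> null_sets lborel" using null by blast
  thus ?thesis
  proof (rule AE_I'[OF _ subsetI])
    fix \<theta> assume "\<theta> \<in> {\<theta> \<in> space lborel. \<not> (\<theta> \<in> {0..2*pi} \<longrightarrow> (\<exists>L. ((\<lambda>r. F (of_real r * cis \<theta>)) \<longlongrightarrow> L) (at_left 1)))}"
    hence \<theta>: "\<theta> \<in> {0..2*pi}" and nl: "\<not> (\<exists>L. ((\<lambda>r. F (of_real r * cis \<theta>)) \<longlongrightarrow> L) (at_left 1))" by auto
    show "\<theta> \<in> (\<Union>m. \<Inter>N. E N m)"
    proof (rule ccontr)
      assume "\<theta> \<notin> (\<Union>m. \<Inter>N. E N m)"
      hence good: "\<exists>N. \<theta> \<notin> E N m" for m by blast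
      \<comment> \<open>The two tails cost at most \<open>e/3\<close> each, the polynomial less than
        \<open>e/6 + e/6\<close>.\<close>
      have "cauchy_filter (filtermap (\<lambda>r. F (of_real r * cis \<theta>)) (at_left 1))"
        unfolding cauchy_filter_metric_filtermap
      proof (intro allI impI)
        fix e :: real assume e: "e > 0"
        obtain m where "3 / e < real m" using reals_Archimedean2 by blast
        hence m: "1 / (real m + 1) < e / 3" using e by (simp add: field_simps)
        obtain N where N: "\<theta> \<notin> E N m" using good by blast
        have Tle: "cmod (T N (of_real r * cis \<theta>)) \<le> e/3" if "r \<in> {0..<1}" for r
        proof -
          have "(cmod (T N (of_real r * cis \<theta>)))\<^sup>2 \<le> (1 / (real m + 1))\<^sup>2"
            using N \<theta> that unfolding E_def by (auto simp: not_less norm_power)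
          hence "cmod (T N (of_real r * cis \<theta>)) \<le> 1 / (real m + 1)" by (rule power2_le_imp_le) auto
          with m show ?thesis by simp
        qed
        have "((\<lambda>r. P N (of_real r * cis \<theta>)) \<longlongrightarrow> P N (of_real 1 * cis \<theta>)) (at_left 1)"
          unfolding P_def by (intro tendsto_intros)
        hence "eventually (\<lambda>r. dist (P N (of_real r * cis \<theta>)) (P N (of_real 1 * cis \<theta>)) < e/6) (at_left 1)"
          using e by (intro tendstoD) auto
        moreover have "eventually (\<lambda>R. R \<in> {0..<1}) (at_left (1::real))"
          by (rule eventually_at_leftI[of 0]) auto
        ultimately have ev: "eventually (\<lambda>r. r \<in> {0..<1} \<and> dist (P N (of_real r * cis \<theta>)) (P N (of_real 1 * cis \<theta>)) < e/6) (at_left 1)"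
          by eventually_elim auto
        show "\<exists>Q. eventually Q (at_left 1) \<and> (\<forall>x y. Q x \<and> Q y \<longrightarrow> dist (F (of_real x * cis \<theta>)) (F (of_real y * cis \<theta>)) < e)"
        proof (intro exI conjI, rule ev, intro allI impI)
          fix x y assume xy: "(x \<in> {0..<1} \<and> dist (P N (of_real x * cis \<theta>)) (P N (of_real 1 * cis \<theta>)) < e/6) \<and>
             (y \<in> {0..<1} \<and> dist (P N (of_real y * cis \<theta>)) (P N (of_real 1 * cis \<theta>)) < e/6)"
          have "dist (P N (of_real x * cis \<theta>)) (P N (of_real y * cis \<theta>)) < e/6 + e/6"
            using xy by (intro dist_triangle_less_add[of _ "P N (of_real 1 * cis \<theta>)"]) auto
          moreover have "F z = T N z + P N z" for z by (simp add: T_def)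
          hence "dist (F (of_real x * cis \<theta>)) (F (of_real y * cis \<theta>)) \<le>
             cmod (T N (of_real x * cis \<theta>)) + cmod (T N (of_real y * cis \<theta>)) + dist (P N (of_real x * cis \<theta>)) (P N (of_real y * cis \<theta>))"
            unfolding dist_norm by (smt (verit) add_diff_add norm_triangle_ineq norm_triangle_ineq4)
          ultimately show "dist (F (of_real x * cis \<theta>)) (F (of_real y * cis \<theta>)) < e"
            using Tle[of x] Tle[of y] xy by linarith
        qed
      qed
      hence "\<exists>L. filtermap (\<lambda>r. F (of_real r * cis \<theta>)) (at_left 1) \<le> nhds L"
        by (rule cauchy_filter_complete_converges[where A=UNIV]) (auto simp: filtermap_bot_iff complete_UNIV)
      with nl show False by (auto simp: filterlim_def)
    qed
  qed
qed

section \<open>Distortion of harmonic maps under the radial condition\<close>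

text \<open>\<open>hd\<close> and \<open>gd\<close> stand for the derivatives of the two analytic
  parts of \<open>f\<close>. The second clause of \<open>K\<close> is the dilatation inequality
  divided by \<open>cmod (p z) + cmod (q z)\<close>, and \<open>M\<close> is an explicit bound for
  the Pommerenke quotients.\<close>

locale harmonic_disc_map =
  fixes f :: "complex \<Rightarrow> complex" and hd gd p q :: "complex \<Rightarrow> complex" and K C6 C7 \<delta>3 \<delta>4 M :: real
  assumes hol: "p holomorphic_on ball 0 1" "q holomorphic_on ball 0 1"
    and pq: "p = hd \<and> q = gd \<or> p = gd \<and> q = hd"
    and dom: "\<And>z. z \<in> ball 0 1 \<Longrightarrow> cmod (q z) < cmod (p z)"
    and K: "K \<ge> 1" "\<And>z. z \<in> ball 0 1 \<Longrightarrow> cmod (p z) + cmod (q z) \<le> K * (cmod (p z) - cmod (q z))"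
    and der: "\<And>z. z \<in> ball 0 1 \<Longrightarrow> (f has_derivative (\<lambda>v. hd z * v + cnj (gd z * v))) (at z)"
    and inj: "inj_on f (ball 0 1)"
    and pos: "C6 > 0" "C7 > 0" "\<delta>3 > 0" "0 < \<delta>4" "\<delta>4 < 1" "M > 0"
    and radial: "\<And>\<zeta> \<rho>1 \<rho>2. cmod \<zeta> = 1 \<Longrightarrow> 0 \<le> \<rho>1 \<Longrightarrow> \<rho>1 \<le> \<rho>2 \<Longrightarrow> \<rho>2 < 1 \<Longrightarrow>
           C6 * ((1 - \<rho>1) / (1 - \<rho>2)) powr (\<delta>3 - 1) * (cmod (p (of_real \<rho>1 * \<zeta>)) + cmod (q (of_real \<rho>1 * \<zeta>)))
             \<le> cmod (p (of_real \<rho>2 * \<zeta>)) + cmod (q (of_real \<rho>2 * \<zeta>)) \<and>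
           cmod (p (of_real \<rho>2 * \<zeta>)) + cmod (q (of_real \<rho>2 * \<zeta>))
             \<le> C7 * ((1 - \<rho>2) / (1 - \<rho>1)) powr (\<delta>4 - 1) * (cmod (p (of_real \<rho>1 * \<zeta>)) + cmod (q (of_real \<rho>1 * \<zeta>)))"
    and pommerenke: "\<And>r w1 w2. 0 < r \<Longrightarrow> r < 1 \<Longrightarrow> w1 \<in> f ` sphere 0 r \<Longrightarrow> w2 \<in> f ` sphere 0 r \<Longrightarrow> w1 \<noteq> w2 \<Longrightarrow>
           smaller_subarc_length f r w1 w2 / internal_dist (f ` ball 0 r) w1 w2 \<le> M"
begin

text \<open>The operator norm of the real-linear map
  \<open>v \<mapsto> hd z * v + cnj (gd z * v)\<close>. Its counterpart, the least dilation factor,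
  is \<open>cmod (p z) - cmod (q z)\<close>.\<close>

definition stretch :: "complex \<Rightarrow> real" where
  "stretch z = cmod (p z) + cmod (q z)"

lemma p_nz: "z \<in> ball 0 1 \<Longrightarrow> p z \<noteq> 0"
  using dom[of z] by auto

lemma stretch_bounds:
  assumes "z \<in> ball 0 1"
  shows "cmod (p z) \<le> stretch z" "stretch z \<le> 2 * cmod (p z)" "0 < stretch z"
  using dom[OF assms] norm_ge_zero[of "q z"] unfolding stretch_def by linarith+

lemma stretch_continuous: "continuous_on (ball 0 1) stretch"
  unfolding stretch_def[abs_def] using hol
  by (intro continuous_intros holomorphic_on_imp_continuous_on)

lemma norm_derivative_bounds:
  "cmod (hd z * v + cnj (gd z * v)) \<le> stretch z * cmod v"
  "(cmod (p z) - cmod (q z)) * cmod v \<le> cmod (hd z * v + cnj (gd z * v))"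
proof -
  show "cmod (hd z * v + cnj (gd z * v)) \<le> stretch z * cmod v"
    using pq norm_triangle_ineq[of "hd z * v" "cnj (gd z * v)"]
    by (auto simp: stretch_def norm_mult algebra_simps)
  show "(cmod (p z) - cmod (q z)) * cmod v \<le> cmod (hd z * v + cnj (gd z * v))"
    using pq norm_triangle_ineq2[of "hd z * v" "- cnj (gd z * v)"] norm_triangle_ineq2[of "cnj (gd z * v)" "- (hd z * v)"]
    by (auto simp: norm_mult algebra_simps simp del: complex_cnj_mult)
qed

lemma radial_lower:
  "cmod \<zeta> = 1 \<Longrightarrow> 0 \<le> \<rho>1 \<Longrightarrow> \<rho>1 \<le> \<rho>2 \<Longrightarrow> \<rho>2 < 1 \<Longrightarrow>
     C6 * ((1 - \<rho>1) / (1 - \<rho>2)) powr (\<delta>3 - 1) * stretch (of_real \<rho>1 * \<zeta>) \<le> stretch (of_real \<rho>2 * \<zeta>)"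
  and radial_upper:
  "cmod \<zeta> = 1 \<Longrightarrow> 0 \<le> \<rho>1 \<Longrightarrow> \<rho>1 \<le> \<rho>2 \<Longrightarrow> \<rho>2 < 1 \<Longrightarrow>
     stretch (of_real \<rho>2 * \<zeta>) \<le> C7 * ((1 - \<rho>2) / (1 - \<rho>1)) powr (\<delta>4 - 1) * stretch (of_real \<rho>1 * \<zeta>)"
  using radial[of \<zeta> \<rho>1 \<rho>2] by (auto simp: stretch_def)

section \<open>Comparability of the stretch at points of hyperbolically bounded distance\<close>

definition \<kappa> where "\<kappa> = max (5 * C7) (5 / C6)"

lemma \<kappa>_pos: "\<kappa> > 0" using pos by (simp add: \<kappa>_def less_max_iff_disj)

text \<open>Both exponents exceed \<open>-1\<close> since \<delta>3 and \<delta>4 are positive; a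
  ratio of boundary distances between \<open>1/5\<close> and \<open>1\<close> therefore costs at
  most a factor 5 in either radial inequality. This ratio is the one that occurs in
  \<open>log_deriv_step\<close>.\<close>

lemma radial_comparable:
  assumes "cmod \<zeta> = 1" "0 \<le> \<rho>1" "\<rho>1 \<le> \<rho>2" "\<rho>2 < 1" and le: "1 - \<rho>1 \<le> 5 * (1 - \<rho>2)"
  shows "stretch (of_real \<rho>2 * \<zeta>) \<le> \<kappa> * stretch (of_real \<rho>1 * \<zeta>)"
    "stretch (of_real \<rho>1 * \<zeta>) \<le> \<kappa> * stretch (of_real \<rho>2 * \<zeta>)"
proof -
  have b: "of_real \<rho>1 * \<zeta> \<in> ball 0 1" "of_real \<rho>2 * \<zeta> \<in> ball 0 1" using assms by (auto simp: norm_mult)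
  define x where "x = (1 - \<rho>2) / (1 - \<rho>1)"
  have x: "1/5 \<le> x" "x \<le> 1" using assms by (auto simp: x_def field_simps)
  have "x powr (\<delta>4 - 1) \<le> x powr (-1)" using x pos by (intro powr_mono') auto
  also have "\<dots> \<le> 5" using x by (simp add: powr_minus field_simps)
  finally have "C7 * x powr (\<delta>4 - 1) * stretch (of_real \<rho>1 * \<zeta>) \<le> C7 * 5 * stretch (of_real \<rho>1 * \<zeta>)"
    using pos stretch_bounds[OF b(1)] by (intro mult_right_mono mult_left_mono) auto
  also have "\<dots> \<le> \<kappa> * stretch (of_real \<rho>1 * \<zeta>)"
    using stretch_bounds[OF b(1)] by (intro mult_right_mono) (auto simp: \<kappa>_def)
  finally show "stretch (of_real \<rho>2 * \<zeta>) \<le> \<kappa> * stretch (of_real \<rho>1 * \<zeta>)"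
    using radial_upper[OF assms(1-4)] by (simp add: x_def)
  have y: "(1 - \<rho>1) / (1 - \<rho>2) = 1 / x" by (simp add: x_def)
  have "1/5 \<le> (1 / x) powr (-1)" using x by (simp add: powr_minus)
  also have "\<dots> \<le> (1 / x) powr (\<delta>3 - 1)" using x pos by (intro powr_mono) auto
  finally have "C6 * (1/5) * stretch (of_real \<rho>1 * \<zeta>) \<le> C6 * (1 / x) powr (\<delta>3 - 1) * stretch (of_real \<rho>1 * \<zeta>)"
    using pos stretch_bounds[OF b(1)] by (intro mult_right_mono mult_left_mono) auto
  also have "\<dots> \<le> stretch (of_real \<rho>2 * \<zeta>)" using radial_lower[OF assms(1-4)] y by simp
  finally have "stretch (of_real \<rho>1 * \<zeta>) \<le> 5 / C6 * stretch (of_real \<rho>2 * \<zeta>)" using pos by (simp add: field_simps)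
  also have "\<dots> \<le> \<kappa> * stretch (of_real \<rho>2 * \<zeta>)"
    using stretch_bounds[OF b(2)] by (intro mult_right_mono) (auto simp: \<kappa>_def)
  finally show "stretch (of_real \<rho>1 * \<zeta>) \<le> \<kappa> * stretch (of_real \<rho>2 * \<zeta>)" .
qed

text \<open>The point \<open>s z\<close> satisfies \<open>1 - |s z| = 2 (1 - |z|)\<close>; the resulting factor \<open>1/2\<close> lets the supremum
  of \<open>(1 - |z|) |p'(z) / p(z)|\<close> over a closed disc absorb the first term.\<close>

lemma log_deriv_step:
  assumes z: "1/2 \<le> cmod z" "cmod z < 1"
  defines "s \<equiv> (2 * cmod z - 1) / cmod z"
  shows "(1 - cmod z) * cmod (deriv p z / p z)
     \<le> (1 - cmod (of_real s * z)) * cmod (deriv p (of_real s * z) / p (of_real s * z)) / 2 + 8 * \<kappa>\<^sup>2"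
proof -
  define d where "d = (1 - cmod z) / 2"
  have d: "d > 0" using z by (simp add: d_def)
  have zp: "cmod z > 0" using z(1) by linarith
  have s: "0 \<le> s" "s < 1" "s * cmod z = 2 * cmod z - 1" using z zp by (simp_all add: s_def pos_divide_less_eq)
  have s1: "1 - s \<le> 4 * d"
  proof -
    have "1 - s = (1 - cmod z) / cmod z" using zp by (simp add: s_def field_simps)
    also have "\<dots> \<le> (1 - cmod z) / (1/2)" using z by (intro divide_left_mono) auto
    finally show ?thesis by (simp add: d_def)
  qed
  \<comment> \<open>\<open>w\<close> and \<open>s * w\<close> lie on one radius, so the radial
    condition alone bounds \<open>E\<close> from above and away from zero on a full disc. Holomorphy
    then turns this into a derivative bound, that is, into information in all directions.\<close>
  define E where "E w = p w / p (of_real s * w)" for w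
  have sw: "of_real s * w \<in> ball 0 1" if "w \<in> ball 0 1" for w :: complex
  proof -
    have "s * cmod w \<le> 1 * cmod w" using s by (intro mult_right_mono) auto
    thus ?thesis using that s by (simp add: norm_mult)
  qed
  have sub: "cball z d \<subseteq> ball 0 1"
  proof
    fix w assume "w \<in> cball z d"
    hence "cmod w \<le> cmod z + d" using norm_triangle_ineq[of z "w - z"] by (auto simp: dist_norm norm_minus_commute)
    also have "\<dots> < 1" using z by (simp add: d_def field_simps)
    finally show "w \<in> ball 0 1" by simp
  qed
  have Ebd: "cmod (E w) \<le> 2 * \<kappa>" "1 / (2 * \<kappa>) \<le> cmod (E w)" if w: "w \<in> cball z d" for w
  proof -
    have wb: "w \<in> ball 0 1" using sub w by blast
    have "cmod w \<le> cmod z + d" using w norm_triangle_ineq[of z "w - z"] by (auto simp: dist_norm norm_minus_commute)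
    hence wd: "d \<le> 1 - cmod w" by (simp add: d_def field_simps)
    have "cmod z - d \<le> cmod w" using w norm_triangle_ineq2[of z "z - w"] by (auto simp: dist_norm norm_minus_commute)
    moreover have "d < cmod z" using z by (simp add: d_def field_simps)
    ultimately have w0: "cmod w > 0" by linarith
    define \<zeta> where "\<zeta> = w / of_real (cmod w)"
    have \<zeta>: "cmod \<zeta> = 1" "w = of_real (cmod w) * \<zeta>" "of_real s * w = of_real (s * cmod w) * \<zeta>"
      using w0 by (auto simp: \<zeta>_def norm_divide)
    have le: "s * cmod w \<le> cmod w" using s mult_left_le_one_le[of "cmod w" s] by simp
    have "1 - s * cmod w = (1 - cmod w) + (1 - s) * cmod w" by (simp add: algebra_simps)
    also have "(1 - s) * cmod w \<le> (1 - s) * 1" using s wd d by (intro mult_left_mono) auto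
    also have "(1 - s) * 1 \<le> 4 * (1 - cmod w)" using s1 wd by simp
    \<comment> \<open>On the disc \<open>d \<le> 1 - cmod w\<close>, so the two summands contribute
      1 and 4; this is the origin of the ratio 5.\<close>
    finally have "1 - s * cmod w \<le> 5 * (1 - cmod w)" by simp
    from radial_comparable[OF \<zeta>(1) _ le _ this] s wb
    have c: "stretch w \<le> \<kappa> * stretch (of_real s * w)" "stretch (of_real s * w) \<le> \<kappa> * stretch w"
      unfolding \<zeta>(3) using \<zeta>(2) by auto
    have nz: "cmod (p (of_real s * w)) > 0" "cmod (p w) > 0" using p_nz[OF sw[OF wb]] p_nz[OF wb] by auto
    have "cmod (p w) \<le> \<kappa> * (2 * cmod (p (of_real s * w)))"
      using c(1) stretch_bounds[OF wb] stretch_bounds[OF sw[OF wb]] \<kappa>_pos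
      by (meson mult_left_mono order_trans less_imp_le)
    thus "cmod (E w) \<le> 2 * \<kappa>" using nz by (simp add: E_def norm_divide field_simps)
    have "cmod (p (of_real s * w)) \<le> \<kappa> * (2 * cmod (p w))"
      using c(2) stretch_bounds[OF wb] stretch_bounds[OF sw[OF wb]] \<kappa>_pos
      by (meson mult_left_mono order_trans less_imp_le)
    thus "1 / (2 * \<kappa>) \<le> cmod (E w)" using nz \<kappa>_pos by (simp add: E_def norm_divide field_simps)
  qed
  have zb: "z \<in> ball 0 1" using z by simp
  have "(\<lambda>w. p (of_real s * w)) holomorphic_on ball 0 1"
    by (rule holomorphic_on_compose_gen[OF _ hol(1), unfolded o_def]) (use sw in \<open>auto intro!: holomorphic_intros\<close>)
  hence Eh: "E holomorphic_on ball 0 1" unfolding E_def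
    using p_nz[OF sw] hol(1) by (intro holomorphic_intros) auto
  have "cmod ((deriv ^^ 1) E z) \<le> fact 1 * (2 * \<kappa>) / d ^ 1"
  proof (rule Cauchy_inequality)
    show "E holomorphic_on ball z d" using Eh sub by (meson ball_subset_cball holomorphic_on_subset order_trans)
    show "continuous_on (cball z d) E" using Eh sub by (meson continuous_on_subset holomorphic_on_imp_continuous_on)
    show "cmod (E x) \<le> 2 * \<kappa>" if "cmod (z - x) = d" for x using Ebd(1)[of x] that by (simp add: dist_norm)
  qed fact
  hence dE: "cmod (deriv E z) \<le> 2 * \<kappa> / d" by simp
  have "(E has_field_derivative (deriv p z * p (of_real s * z) - p z * (deriv p (of_real s * z) * of_real s)) / (p (of_real s * z) * p (of_real s * z))) (at z)"
  proof -
    have d1: "(p has_field_derivative deriv p z) (at z)" if "z \<in> ball 0 1" for z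
      using holomorphic_derivI[OF hol(1) open_ball that] .
    have "((\<lambda>w. p (of_real s * w)) has_field_derivative deriv p (of_real s * z) * of_real s) (at z)"
      by (rule DERIV_chain2[where f=p]) (use d1[OF sw[OF zb]] in \<open>auto intro!: derivative_eq_intros\<close>)
    from DERIV_divide[OF d1[OF zb] this p_nz[OF sw[OF zb]]] show ?thesis by (simp add: E_def[abs_def])
  qed
  hence "deriv E z = (deriv p z * p (of_real s * z) - p z * (deriv p (of_real s * z) * of_real s)) / (p (of_real s * z) * p (of_real s * z))"
    by (rule DERIV_imp_deriv)
  \<comment> \<open>The logarithmic derivative of \<open>E\<close> is the difference of that of
    \<open>p\<close> at \<open>z\<close> and \<open>s\<close> times that of \<open>p\<close> at
    \<open>s * z\<close>; the Cauchy estimate bounds it by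
    \<open>4 * \<kappa>\<^sup>2 / d\<close>.\<close>
  hence quot: "deriv E z / E z = deriv p z / p z - of_real s * (deriv p (of_real s * z) / p (of_real s * z))"
    using p_nz[OF zb] p_nz[OF sw[OF zb]] by (simp add: E_def field_simps)
  have "cmod (deriv E z / E z) \<le> (2 * \<kappa> / d) / (1 / (2 * \<kappa>))"
    unfolding norm_divide using Ebd(2)[of z] dE \<kappa>_pos d by (intro frac_le) auto
  also have "\<dots> = 4 * \<kappa>\<^sup>2 / d" by (simp add: power2_eq_square)
  finally have "cmod (deriv p z / p z - of_real s * (deriv p (of_real s * z) / p (of_real s * z))) \<le> 4 * \<kappa>\<^sup>2 / d"
    unfolding quot .
  hence "cmod (deriv p z / p z) \<le> cmod (of_real s * (deriv p (of_real s * z) / p (of_real s * z))) + 4 * \<kappa>\<^sup>2 / d"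
    using norm_triangle_ineq2[of "deriv p z / p z" "of_real s * (deriv p (of_real s * z) / p (of_real s * z))"] by linarith
  also have "cmod (of_real s * (deriv p (of_real s * z) / p (of_real s * z))) \<le> 1 * cmod (deriv p (of_real s * z) / p (of_real s * z))"
    unfolding norm_mult using s by (intro mult_right_mono) auto
  finally have "2 * d * cmod (deriv p z / p z) \<le> 2 * d * (1 * cmod (deriv p (of_real s * z) / p (of_real s * z)) + 4 * \<kappa>\<^sup>2 / d)"
    using d by (intro mult_left_mono) auto
  also have "\<dots> = 2 * d * cmod (deriv p (of_real s * z) / p (of_real s * z)) + 8 * \<kappa>\<^sup>2" using d by (simp add: field_simps)
  finally have *: "2 * d * cmod (deriv p z / p z) \<le> 2 * d * cmod (deriv p (of_real s * z) / p (of_real s * z)) + 8 * \<kappa>\<^sup>2" .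
  have e: "1 - cmod z = 2 * d" "1 - cmod (of_real s * z) = 4 * d" using s by (simp_all add: d_def norm_mult)
  show ?thesis using * unfolding e by simp
qed

text \<open>Absorption needs a supremum known to be finite, so \<open>\<psi>\<close> is maximised
  over closed discs of radius \<open>R < 1\<close>. At a maximum point with modulus above
  \<open>1/2\<close> it yields \<open>16 * \<kappa>\<^sup>2\<close>; the remaining points are
  covered by the maximum over \<open>cball 0 (1/2)\<close>. Both bounds are free of
  \<open>R\<close>.\<close>

lemma log_deriv_bound:
  obtains B where "B > 0" "\<And>z. z \<in> ball 0 1 \<Longrightarrow> (1 - cmod z) * cmod (deriv p z / p z) \<le> B"
proof -
  define \<psi> where "\<psi> z = (1 - cmod z) * cmod (deriv p z / p z)" for z
  have cont: "continuous_on (cball 0 R) \<psi>" if "R < 1" for R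
  proof -
    have "cball 0 R \<subseteq> (ball 0 1 :: complex set)" using that by auto
    hence "continuous_on (cball 0 R) (deriv p)" "continuous_on (cball 0 R) p"
      using hol(1) holomorphic_deriv[OF hol(1) open_ball] holomorphic_on_imp_continuous_on continuous_on_subset by blast+
    thus ?thesis unfolding \<psi>_def using p_nz \<open>cball 0 R \<subseteq> ball 0 1\<close>
      by (intro continuous_intros) auto
  qed
  have half_less: "(1/2::real) < 1" by simp
  have "cball 0 (1/2) \<noteq> ({} :: complex set)" by simp
  then obtain z1 where z1: "\<And>z. z \<in> cball 0 (1/2) \<Longrightarrow> \<psi> z \<le> \<psi> z1"
    using continuous_attains_sup[OF compact_cball _ cont[of "1/2"]] half_less by blast
  define B where "B = max (\<psi> z1) (16 * \<kappa>\<^sup>2)"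
  have "\<psi> z \<le> B" if z: "z \<in> ball 0 1" for z
  proof -
    define R where "R = max (cmod z) (1/2)"
    have R: "R < 1" "R \<ge> 0" "z \<in> cball 0 R" using z by (auto simp: R_def)
    hence "cball 0 R \<noteq> ({} :: complex set)" by blast
    then obtain z0 where z0: "z0 \<in> cball 0 R" "\<And>w. w \<in> cball 0 R \<Longrightarrow> \<psi> w \<le> \<psi> z0"
      using continuous_attains_sup[OF compact_cball _ cont[OF R(1)]] by blast
    have "\<psi> z0 \<le> B"
    proof (cases "cmod z0 \<le> 1/2")
      case True thus ?thesis using z1[of z0] by (auto simp: B_def)
    next
      case False
      define s where "s = (2 * cmod z0 - 1) / cmod z0"
      have "cmod z0 > 0" using False by linarith
      hence s: "0 \<le> s" "s \<le> 1" using False z0(1) R(1) by (simp_all add: s_def pos_divide_le_eq)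
      have "s * cmod z0 \<le> 1 * cmod z0" using s by (intro mult_right_mono) auto
      hence "of_real s * z0 \<in> cball 0 R" using z0(1) s by (simp add: norm_mult)
      moreover have "\<psi> z0 \<le> \<psi> (of_real s * z0) / 2 + 8 * \<kappa>\<^sup>2"
        using log_deriv_step[of z0] False z0(1) R by (simp add: \<psi>_def s_def)
      ultimately have "\<psi> z0 \<le> \<psi> z0 / 2 + 8 * \<kappa>\<^sup>2" using z0(2)[of "of_real s * z0"] by linarith
      thus ?thesis by (simp add: B_def)
    qed
    thus ?thesis using z0(2)[OF R(3)] by linarith
  qed
  moreover have "B > 0" using \<kappa>_pos by (simp add: B_def less_max_iff_disj)
  ultimately show ?thesis using that by (simp add: \<psi>_def)
qed

text \<open>A bound for \<open>p' / p\<close> is a Lipschitz bound for a holomorphic logarithm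
  \<open>L\<close> of \<open>p\<close> on the convex set \<open>cball 0 R\<close>, where the
  distance to the circle is at least \<open>1 - R\<close>. The factor 2 is the gap between
  \<open>cmod (p z)\<close> and the stretch.\<close>

lemma stretch_comparable:
  obtains B where "B > 0" "\<And>R z w. R < 1 \<Longrightarrow> z \<in> cball 0 R \<Longrightarrow> w \<in> cball 0 R \<Longrightarrow>
     stretch w \<le> 2 * exp (B * cmod (w - z) / (1 - R)) * stretch z"
proof -
  obtain B where B: "B > 0" "\<And>z. z \<in> ball 0 1 \<Longrightarrow> (1 - cmod z) * cmod (deriv p z / p z) \<le> B"
    using log_deriv_bound by blast
  obtain L where L: "L holomorphic_on ball 0 1" "\<And>z. z \<in> ball 0 1 \<Longrightarrow> p z = exp (L z)"
    using contractible_imp_holomorphic_log[OF hol(1) convex_imp_contractible[OF convex_ball] p_nz] by blast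
  have dL: "deriv L z = deriv p z / p z" if z: "z \<in> ball 0 1" for z
  proof -
    have "((\<lambda>z. exp (L z)) has_field_derivative exp (L z) * deriv L z) (at z)"
      using holomorphic_derivI[OF L(1) open_ball z] by (auto intro!: derivative_eq_intros)
    hence "(p has_field_derivative exp (L z) * deriv L z) (at z)"
      by (rule has_field_derivative_transform_within_open[OF _ open_ball z]) (use L(2) in auto)
    thus ?thesis using DERIV_imp_deriv L(2)[OF z] by (metis exp_not_eq_zero nonzero_mult_div_cancel_left)
  qed
  have "stretch w \<le> 2 * exp (B * cmod (w - z) / (1 - R)) * stretch z"
    if R: "R < 1" and z: "z \<in> cball 0 R" and w: "w \<in> cball 0 R" for R z w
  proof -
    have sub: "cball 0 R \<subseteq> (ball 0 1 :: complex set)" using R by auto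
    have zb: "z \<in> ball 0 1" "w \<in> ball 0 1" using z w sub by auto
    have "cmod (L w - L z) \<le> B / (1 - R) * cmod (w - z)"
    proof (rule field_differentiable_bound[OF convex_cball _ _ w z])
      fix x :: complex assume x: "x \<in> cball 0 R"
      hence xb: "x \<in> ball 0 1" using sub by auto
      show "(L has_field_derivative deriv L x) (at x within cball 0 R)"
        using holomorphic_derivI[OF L(1) open_ball xb] by (rule has_field_derivative_at_within)
      have "(1 - R) * cmod (deriv L x) \<le> (1 - cmod x) * cmod (deriv L x)"
        using x by (intro mult_right_mono) auto
      also have "\<dots> \<le> B" using B(2)[OF xb] dL[OF xb] by simp
      finally show "cmod (deriv L x) \<le> B / (1 - R)" using R by (simp add: field_simps)
    qed
    hence "Re (L w) \<le> B * cmod (w - z) / (1 - R) + Re (L z)" 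
      using complex_Re_le_cmod[of "L w - L z"] by simp
    hence "exp (Re (L w)) \<le> exp (B * cmod (w - z) / (1 - R)) * exp (Re (L z))" by (simp flip: exp_add)
    hence *: "cmod (p w) \<le> exp (B * cmod (w - z) / (1 - R)) * cmod (p z)"
      using L(2)[OF zb(1)] L(2)[OF zb(2)] by simp
    also have "\<dots> \<le> exp (B * cmod (w - z) / (1 - R)) * stretch z"
      using stretch_bounds[OF zb(1)] by (intro mult_left_mono) auto
    finally show ?thesis using stretch_bounds(2)[OF zb(2)] by simp
  qed
  thus ?thesis using that B(1) by blast
qed

text \<open>\<open>\<phi>\<close> is a primitive of the radial majorant of the stretch. Because
  \<delta>4 > 0 it increases to 0 at the boundary, so the increment is at most
  \<open>- \<phi> \<rho>1\<close>, however close \<open>\<rho>2\<close> is to 1.\<close>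

lemma radial_increment:
  assumes \<zeta>: "cmod \<zeta> = 1" and \<rho>: "0 \<le> \<rho>1" "\<rho>1 \<le> \<rho>2" "\<rho>2 < 1"
  shows "cmod (f (of_real \<rho>2 * \<zeta>) - f (of_real \<rho>1 * \<zeta>)) \<le> C7 / \<delta>4 * (1 - \<rho>1) * stretch (of_real \<rho>1 * \<zeta>)"
proof (cases "\<rho>1 = \<rho>2")
  case True
  thus ?thesis using pos \<rho> stretch_bounds(3)[of "of_real \<rho>1 * \<zeta>"] \<zeta> by (simp add: norm_mult)
next
  case False
  hence lt: "\<rho>1 < \<rho>2" using \<rho> by simp
  define S where "S = stretch (of_real \<rho>1 * \<zeta>)"
  define d where "d = 1 - \<rho>1"
  have d: "d > 0" using \<rho> lt by (simp add: d_def)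
  have S: "S > 0" using stretch_bounds(3)[of "of_real \<rho>1 * \<zeta>"] \<rho> \<zeta> by (simp add: S_def norm_mult)
  define \<phi> where "\<phi> s = - (C7 * S * d / \<delta>4) * ((1 - s) / d) powr \<delta>4" for s
  have "norm (f (of_real \<rho>2 * \<zeta>) - f (of_real \<rho>1 * \<zeta>)) \<le> \<phi> \<rho>2 - \<phi> \<rho>1"
  proof (rule differentiable_bound_general[OF lt, where f="\<lambda>s. f (of_real s * \<zeta>)"
        and f'="\<lambda>s. hd (of_real s * \<zeta>) * \<zeta> + cnj (gd (of_real s * \<zeta>) * \<zeta>)"
        and \<phi>'="\<lambda>s. C7 * ((1 - s) / d) powr (\<delta>4 - 1) * S"])
    show "continuous_on {\<rho>1..\<rho>2} \<phi>" unfolding \<phi>_def using \<rho> d pos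
      by (intro continuous_intros) auto
    have b: "of_real s * \<zeta> \<in> ball 0 1" if "s \<in> {\<rho>1..\<rho>2}" for s using that \<rho> \<zeta> by (simp add: norm_mult)
    have "continuous_on (ball 0 1) f"
      using der by (meson continuous_at_imp_continuous_on has_derivative_continuous)
    thus "continuous_on {\<rho>1..\<rho>2} (\<lambda>s. f (of_real s * \<zeta>))"
      by (rule continuous_on_compose2) (use b in \<open>auto intro!: continuous_intros\<close>)
    fix s assume s: "\<rho>1 < s" "s < \<rho>2"
    have "((\<lambda>s. of_real s * \<zeta>) has_derivative (\<lambda>v. of_real v * \<zeta>)) (at s)" by (auto intro!: derivative_eq_intros)
    from has_derivative_compose[OF this der[OF b]] s
    have "((\<lambda>s. f (of_real s * \<zeta>)) has_derivative (\<lambda>v. hd (of_real s * \<zeta>) * (of_real v * \<zeta>) + cnj (gd (of_real s * \<zeta>) * (of_real v * \<zeta>)))) (at s)"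
      by auto
    thus "((\<lambda>s. f (of_real s * \<zeta>)) has_vector_derivative hd (of_real s * \<zeta>) * \<zeta> + cnj (gd (of_real s * \<zeta>) * \<zeta>)) (at s)"
      unfolding has_vector_derivative_def by (rule has_derivative_eq_rhs) (auto simp: scaleR_conv_of_real algebra_simps)
    have "(\<phi> has_real_derivative - (C7 * S * d / \<delta>4) * (\<delta>4 * ((1 - s) / d) powr (\<delta>4 - 1) * (-1 / d))) (at s)"
      unfolding \<phi>_def using s \<rho> d by (auto intro!: derivative_eq_intros)
    also have "- (C7 * S * d / \<delta>4) * (\<delta>4 * ((1 - s) / d) powr (\<delta>4 - 1) * (-1 / d)) = C7 * ((1 - s) / d) powr (\<delta>4 - 1) * S"
      using d pos by simp
    finally show "(\<phi> has_vector_derivative C7 * ((1 - s) / d) powr (\<delta>4 - 1) * S) (at s)"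
      by (simp add: has_real_derivative_iff_has_vector_derivative)
    have "norm (hd (of_real s * \<zeta>) * \<zeta> + cnj (gd (of_real s * \<zeta>) * \<zeta>)) \<le> stretch (of_real s * \<zeta>)"
      using norm_derivative_bounds(1)[of "of_real s * \<zeta>" \<zeta>] \<zeta> by simp
    also have "\<dots> \<le> C7 * ((1 - s) / d) powr (\<delta>4 - 1) * S"
      using radial_upper[OF \<zeta> \<rho>(1), of s] s \<rho> by (simp add: S_def d_def)
    finally show "norm (hd (of_real s * \<zeta>) * \<zeta> + cnj (gd (of_real s * \<zeta>) * \<zeta>)) \<le> C7 * ((1 - s) / d) powr (\<delta>4 - 1) * S" .
  qed
  also have "\<dots> \<le> - \<phi> \<rho>1" using pos S d by (simp add: \<phi>_def)
  also have "- \<phi> \<rho>1 = C7 / \<delta>4 * d * S" using d by (simp add: \<phi>_def d_def)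
  finally show ?thesis by (simp add: S_def d_def)
qed

text \<open>The comparison of stretches degenerates at the boundary, so it is used only inside
  \<open>cball 0 (cmod z)\<close>. A point \<open>w\<close> further out is reached by a segment from
  \<open>z\<close> to the radial projection \<open>w'\<close> of \<open>w\<close> onto the circle
  through \<open>z\<close>, and then by the radial segment from \<open>w'\<close> to
  \<open>w\<close>, which \<open>radial_increment\<close> controls uniformly.\<close>

lemma local_oscillation:
  assumes "C0 \<ge> 0"
  obtains C where "C > 0" "\<And>z w. z \<in> ball 0 1 \<Longrightarrow> w \<in> ball 0 1 \<Longrightarrow> cmod (w - z) \<le> C0 * (1 - cmod z) \<Longrightarrow>
     cmod (f w - f z) \<le> C * (1 - cmod z) * stretch z"
proof -
  obtain B where B: "B > 0" "\<And>R z w. R < 1 \<Longrightarrow> z \<in> cball 0 R \<Longrightarrow> w \<in> cball 0 R \<Longrightarrow>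
     stretch w \<le> 2 * exp (B * cmod (w - z) / (1 - R)) * stretch z"
    using stretch_comparable by blast
  \<comment> \<open>The projection moves \<open>w\<close> by at most \<open>cmod (w - z)\<close>,
    which doubles the allowed distance.\<close>
  define c where "c = 2 * C0"
  define D where "D = 2 * exp (B * c)"
  have c: "c \<ge> 0" "D > 0" using assms by (auto simp: c_def D_def)
  have near: "stretch x \<le> D * stretch z"
    if "z \<in> ball 0 1" "cmod x \<le> cmod z" "cmod (x - z) \<le> c * (1 - cmod z)" for x z
  proof -
    have "B * cmod (x - z) \<le> B * (c * (1 - cmod z))" using that B(1) by (intro mult_left_mono) auto
    hence "B * cmod (x - z) / (1 - cmod z) \<le> B * c" using that(1) by (simp add: pos_divide_le_eq mult_ac)
    hence "2 * exp (B * cmod (x - z) / (1 - cmod z)) * stretch z \<le> D * stretch z"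
      unfolding D_def using stretch_bounds(3)[OF that(1)] by (intro mult_right_mono mult_left_mono) auto
    thus ?thesis using B(2)[of "cmod z" z x] that by simp
  qed
  have seg: "cmod (f x - f z) \<le> c * D * (1 - cmod z) * stretch z"
    if z: "z \<in> ball 0 1" and x: "cmod x \<le> cmod z" "cmod (x - z) \<le> c * (1 - cmod z)" for x z
  proof -
    have in_seg: "cmod y \<le> cmod z" "cmod (y - z) \<le> cmod (x - z)" if "y \<in> closed_segment z x" for y
    proof -
      have "closed_segment z x \<subseteq> cball 0 (cmod z)" using x by (intro closed_segment_subset convex_cball) auto
      thus "cmod y \<le> cmod z" using that by auto
      show "cmod (y - z) \<le> cmod (x - z)" using segment_bound(1)[OF that] by (simp add: norm_minus_commute)
    qed
    have "norm (f x - f z) \<le> (D * stretch z) * norm (x - z)"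
    proof (rule differentiable_bound[OF convex_closed_segment[of z x]])
      fix y assume y: "y \<in> closed_segment z x"
      have yb: "y \<in> ball 0 1" using in_seg[OF y] z by simp
      show "(f has_derivative (\<lambda>v. hd y * v + cnj (gd y * v))) (at y within closed_segment z x)"
        using der[OF yb] by (rule has_derivative_at_withinI)
      have "stretch y \<le> D * stretch z" using near[OF z] in_seg[OF y] x by auto
      thus "onorm (\<lambda>v. hd y * v + cnj (gd y * v)) \<le> D * stretch z"
        by (intro onorm_le order_trans[OF norm_derivative_bounds(1)] mult_right_mono) auto
    qed auto
    also have "\<dots> \<le> (D * stretch z) * (c * (1 - cmod z))"
      using c x stretch_bounds(3)[OF z] by (intro mult_left_mono) auto
    finally show ?thesis by (simp add: mult_ac)
  qed
  define C where "C = C7 / \<delta>4 * D + c * D + 1"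
  have "cmod (f w - f z) \<le> C * (1 - cmod z) * stretch z"
    if z: "z \<in> ball 0 1" and w: "w \<in> ball 0 1" and zw: "cmod (w - z) \<le> C0 * (1 - cmod z)" for z w
  proof -
    have S: "(1 - cmod z) * stretch z \<ge> 0" using z stretch_bounds(3)[OF z] by simp
    show ?thesis
    proof (cases "cmod w \<le> cmod z")
      case True
      have "C0 * (1 - cmod z) \<le> c * (1 - cmod z)" using assms z by (intro mult_right_mono) (auto simp: c_def)
      hence "cmod (f w - f z) \<le> c * D * ((1 - cmod z) * stretch z)" using seg[OF z True] zw by (simp add: mult_ac)
      also have "\<dots> \<le> C * ((1 - cmod z) * stretch z)" using S c pos by (intro mult_right_mono) (auto simp: C_def)
      finally show ?thesis by (simp add: mult_ac)
    next
      case False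
      define \<zeta> where "\<zeta> = w / of_real (cmod w)"
      define w' where "w' = of_real (cmod z) * \<zeta>"
      have w0: "cmod w > 0" using False norm_ge_zero[of z] by linarith
      have \<zeta>: "cmod \<zeta> = 1" "w = of_real (cmod w) * \<zeta>" using w0 by (auto simp: \<zeta>_def norm_divide)
      have w': "cmod w' = cmod z" using \<zeta> by (simp add: w'_def norm_mult)
      have "w' - w = of_real (cmod z - cmod w) * \<zeta>" using \<zeta>(2) by (simp only: w'_def of_real_diff left_diff_distrib)
      hence "cmod (w' - w) = cmod w - cmod z" using False \<zeta>(1) by (simp add: norm_mult del: of_real_diff)
      also have "\<dots> \<le> cmod (w - z)" by (rule norm_triangle_ineq2)
      finally have "cmod (w' - z) \<le> c * (1 - cmod z)"
        using zw norm_triangle_ineq[of "w' - w" "w - z"] by (simp add: c_def)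
      note w'z = near[OF z _ this] seg[OF z _ this]
      have "cmod (f w - f w') \<le> C7 / \<delta>4 * (1 - cmod z) * stretch w'"
        using radial_increment[OF \<zeta>(1), of "cmod z" "cmod w"] False w unfolding w'_def \<zeta>(2)[symmetric] by simp
      also have "\<dots> \<le> C7 / \<delta>4 * (1 - cmod z) * (D * stretch z)"
        using w'z(1) w' pos z by (intro mult_left_mono) auto
      finally have "cmod (f w - f z) \<le> C7 / \<delta>4 * (1 - cmod z) * (D * stretch z) + c * D * (1 - cmod z) * stretch z"
        using w'z(2) w' norm_triangle_ineq[of "f w - f w'" "f w' - f z"] by simp
      also have "\<dots> = (C7 / \<delta>4 * D + c * D) * ((1 - cmod z) * stretch z)" by (simp add: algebra_simps)
      also have "\<dots> \<le> C * ((1 - cmod z) * stretch z)" using S by (intro mult_right_mono) (auto simp: C_def)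
      finally show ?thesis by (simp add: mult_ac)
    qed
  qed
  moreover have "C > 0" unfolding C_def using c pos
    by (intro add_nonneg_pos add_nonneg_nonneg) auto
  ultimately show ?thesis using that by blast
qed

end

section \<open>Lengths of boundary arcs\<close>

lemma cis_eq_cis_obtain:
  assumes "cis s = cis t"
  obtains n :: int where "s = t + 2 * pi * of_int n"
  using assms sin_cos_eq_iff[of s t] by (auto simp: complex_eq_iff)

lemma norm_cis_diff_le: "cmod (cis s - cis t) \<le> \<bar>s - t\<bar>"
proof -
  have "cis s - cis t = cis t * (cis (s - t) - 1)" by (simp add: algebra_simps cis_mult)
  hence "cmod (cis s - cis t) = 2 * \<bar>sin ((s - t)/2)\<bar>" by (simp add: norm_mult norm_cis_minus_1)
  also have "\<dots> \<le> 2 * \<bar>(s - t)/2\<bar>" by (intro mult_left_mono abs_sin_x_le_abs_x) auto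
  finally show ?thesis by simp
qed

context harmonic_disc_map
begin

definition speed :: "real \<Rightarrow> real \<Rightarrow> real" where
  "speed r t = cmod (hd (rcis r t) * (\<i> * rcis r t) + cnj (gd (rcis r t) * (\<i> * rcis r t)))"

lemma rcis_in_ball: "0 \<le> r \<Longrightarrow> r < 1 \<Longrightarrow> rcis r t \<in> ball 0 1"
  by simp

lemma continuous_on_rcis [continuous_intros]: "continuous_on S (rcis r)"
  unfolding rcis_def by (intro continuous_intros)

lemma continuous_on_stretch_rcis: "0 \<le> r \<Longrightarrow> r < 1 \<Longrightarrow> continuous_on S (\<lambda>t. stretch (rcis r t))"
  by (rule continuous_on_compose2[OF stretch_continuous]) (auto intro!: continuous_intros)

lemma continuous_on_speed:
  assumes "0 \<le> r" "r < 1"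
  shows "continuous_on S (speed r)"
proof -
  have "continuous_on (ball 0 1) hd" "continuous_on (ball 0 1) gd"
    using pq hol holomorphic_on_imp_continuous_on by auto
  from this[THEN continuous_on_compose2, of S "rcis r"]
  have "continuous_on S (\<lambda>t. hd (rcis r t))" "continuous_on S (\<lambda>t. gd (rcis r t))"
    using assms by (auto simp: continuous_on_rcis image_subset_iff)
  thus ?thesis unfolding speed_def[abs_def] by (intro continuous_intros)
qed

lemma circ_image_length_eq:
  assumes "0 \<le> r" "r < 1"
  shows "circ_image_length f r a b = integral {a..b} (speed r)"
proof -
  have "norm (vector_derivative (\<lambda>t. f (rcis r t)) (at t)) = speed r t" for t
  proof -
    have "(rcis r has_derivative (\<lambda>v. v *\<^sub>R (\<i> * rcis r t))) (at t)"
      unfolding rcis_def[abs_def] by (auto intro!: derivative_eq_intros simp: mult_ac scaleR_conv_of_real)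
    from has_derivative_compose[OF this der[OF rcis_in_ball[OF assms]]]
    have "((\<lambda>t. f (rcis r t)) has_vector_derivative hd (rcis r t) * (\<i> * rcis r t) + cnj (gd (rcis r t) * (\<i> * rcis r t))) (at t)"
      unfolding has_vector_derivative_def by (rule has_derivative_eq_rhs) (auto simp: scaleR_conv_of_real algebra_simps)
    thus ?thesis by (simp add: vector_derivative_at speed_def)
  qed
  thus ?thesis by (simp add: circ_image_length_def)
qed

text \<open>The tangent vector \<open>\<i> * rcis r t\<close> has length \<open>r\<close>, and the
  derivative scales no direction by less than \<open>cmod (p z) - cmod (q z)\<close>, which is at
  least \<open>stretch z / K\<close>. Through this use of quasiconformality a length bound controls
  the integral of the stretch.\<close>

lemma speed_lower:
  assumes "0 < r" "r < 1"
  shows "r / K * stretch (rcis r t) \<le> speed r t" "0 < speed r t"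
proof -
  let ?z = "rcis r t"
  have z: "?z \<in> ball 0 1" using assms by simp
  have "r / K * stretch ?z \<le> r / K * (K * (cmod (p ?z) - cmod (q ?z)))"
    using K(1) K(2)[OF z] assms by (intro mult_left_mono) (auto simp: stretch_def)
  also have "\<dots> = (cmod (p ?z) - cmod (q ?z)) * cmod (\<i> * ?z)" using K(1) assms by (simp add: norm_mult)
  also have "\<dots> \<le> speed r t" unfolding speed_def by (rule norm_derivative_bounds(2))
  finally show *: "r / K * stretch ?z \<le> speed r t" .
  have "0 < r / K * stretch ?z" using assms K(1) stretch_bounds(3)[OF z] by simp
  with * show "0 < speed r t" by linarith
qed

lemma integral_speed_shift:
  assumes "0 \<le> r" "r < 1"
  shows "integral {a + 2 * pi * of_int n..b + 2 * pi * of_int n} (speed r) = integral {a..b} (speed r)"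
proof -
  have "rcis r (x + 2 * pi * of_int n) = rcis r x" for x
    using cis_multiple_2pi[of "of_int n"] by (simp add: rcis_def flip: cis_mult)
  hence "speed r \<circ> (\<lambda>x. x + 2 * pi * of_int n) = speed r" by (simp add: fun_eq_iff speed_def)
  thus ?thesis using integral_shift[OF continuous_on_speed[OF assms], of a b "2 * pi * of_int n"] by simp
qed

lemma speed_integrable: "0 \<le> r \<Longrightarrow> r < 1 \<Longrightarrow> speed r integrable_on {a..b}"
  by (intro integrable_continuous_real continuous_on_speed)

lemma integral_speed_pos:
  assumes "0 < r" "r < 1" "a < b"
  shows "0 < integral {a..b} (speed r)"
proof -
  obtain x where x: "\<And>y. y \<in> {a..b} \<Longrightarrow> speed r x \<le> speed r y"
  proof -
    have "{a..b} \<noteq> {}" "0 \<le> r" using assms by auto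
    from continuous_attains_inf[OF compact_Icc this(1) continuous_on_speed[OF this(2) assms(2)]] that
    show ?thesis by blast
  qed
  have "0 < (b - a) * speed r x" using assms speed_lower(2)[OF assms(1,2)] by simp
  also have "\<dots> = integral {a..b} (\<lambda>_. speed r x)" using assms by simp
  also have "\<dots> \<le> integral {a..b} (speed r)"
    using x assms by (intro integral_le speed_integrable) auto
  finally show ?thesis .
qed

text \<open>The image of the chord is an admissible arc: the open chord lies in
  \<open>ball 0 r\<close> by strict convexity, and \<open>f\<close> is injective. Conversely every
  admissible arc has diameter at least \<open>dist (f z1) (f z2)\<close>, so the infimum is positive
  and the Pommerenke quotient can be multiplied out.\<close>

lemma internal_dist_bounds:
  assumes r: "r < 1" and z: "z1 \<in> sphere 0 r" "z2 \<in> sphere 0 r" "z1 \<noteq> z2"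
    and D: "\<And>x. x \<in> closed_segment z1 z2 \<Longrightarrow> cmod (f x - c) \<le> D"
  shows "0 < internal_dist (f ` ball 0 r) (f z1) (f z2)" "internal_dist (f ` ball 0 r) (f z1) (f z2) \<le> 2 * D"
proof -
  define X where "X = {diameter (path_image \<gamma>) | \<gamma>. arc \<gamma> \<and> pathstart \<gamma> = f z1 \<and> pathfinish \<gamma> = f z2 \<and>
     path_image \<gamma> - {f z1, f z2} \<subseteq> f ` ball 0 r}"
  have X: "internal_dist (f ` ball 0 r) (f z1) (f z2) = Inf X" by (simp add: internal_dist_def X_def)
  have "closed_segment z1 z2 \<subseteq> cball 0 r" using z by (intro closed_segment_subset convex_cball) auto
  hence sub: "closed_segment z1 z2 \<subseteq> ball 0 1" using r by auto
  have ne: "f z1 \<noteq> f z2" using inj z r sub by (auto dest!: inj_onD)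
  have low: "dist (f z1) (f z2) \<le> d" if d: "d \<in> X" for d
  proof -
    obtain \<gamma> where \<gamma>: "d = diameter (path_image \<gamma>)" "arc \<gamma>" "pathstart \<gamma> = f z1" "pathfinish \<gamma> = f z2"
      using d unfolding X_def by blast
    have "bounded (path_image \<gamma>)" using \<gamma>(2) by (simp add: arc_imp_path bounded_path_image)
    thus ?thesis unfolding \<gamma>(1) using \<gamma>(3,4) pathstart_in_path_image[of \<gamma>] pathfinish_in_path_image[of \<gamma>]
      by (intro diameter_bounded_bound) auto
  qed
  define \<gamma> where "\<gamma> = f \<circ> linepath z1 z2"
  have fc: "continuous_on (ball 0 1) f"
    using der by (meson continuous_at_imp_continuous_on has_derivative_continuous)
  have arc: "arc \<gamma>" unfolding arc_def
  proof
    show "path \<gamma>" unfolding \<gamma>_def using sub by (intro path_continuous_image continuous_on_subset[OF fc]) auto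
    have "inj_on (linepath z1 z2) {0..1}" using arc_linepath[OF z(3)] by (simp add: arc_def)
    moreover have "inj_on f (linepath z1 z2 ` {0..1})"
      using sub by (intro inj_on_subset[OF inj]) (auto simp: linepath_image_01)
    ultimately show "inj_on \<gamma> {0..1}" unfolding \<gamma>_def by (rule comp_inj_on)
  qed
  have im: "path_image \<gamma> = f ` closed_segment z1 z2" by (simp add: \<gamma>_def path_image_compose)
  have "path_image \<gamma> - {f z1, f z2} \<subseteq> f ` ball 0 r"
  proof
    fix y assume "y \<in> path_image \<gamma> - {f z1, f z2}"
    then obtain x where x: "y = f x" "x \<in> closed_segment z1 z2" "x \<noteq> z1" "x \<noteq> z2" by (auto simp: im)
    hence "x \<in> open_segment z1 z2" by (simp add: open_segment_def)
    hence "dist 0 x < r" using dist_decreases_open_segment[of x z1 z2 0] z by auto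
    thus "y \<in> f ` ball 0 r" using x by auto
  qed
  hence mem: "diameter (path_image \<gamma>) \<in> X"
    using arc unfolding X_def by (auto simp: \<gamma>_def pathstart_compose pathfinish_compose intro!: exI[of _ \<gamma>])
  have "Inf X \<le> diameter (path_image \<gamma>)" using mem low by (intro cInf_lower bdd_belowI) auto
  also have "\<dots> \<le> 2 * D" unfolding im
  proof (rule diameter_le)
    fix x y assume "x \<in> f ` closed_segment z1 z2" "y \<in> f ` closed_segment z1 z2"
    hence "cmod (x - c) \<le> D" "cmod (y - c) \<le> D" using D by auto
    thus "norm (x - y) \<le> 2 * D" using norm_triangle_ineq4[of "x - c" "y - c"] by simp
  qed auto
  finally show "internal_dist (f ` ball 0 r) (f z1) (f z2) \<le> 2 * D" unfolding X .
  have "dist (f z1) (f z2) \<le> Inf X" using mem low by (intro cInf_greatest) auto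
  moreover have "0 < dist (f z1) (f z2)" using ne by simp
  ultimately show "0 < internal_dist (f ` ball 0 r) (f z1) (f z2)" unfolding X by linarith
qed

text \<open>The hypothesis only controls the shorter of the two arcs between two points. Applying it to
  the first half, measured by length, of the given arc makes that half the shorter one.\<close>

lemma arc_length_le:
  assumes r: "0 < r" "r < 1" and ab: "a < b" "b \<le> a + 2 * pi"
    and D: "\<And>s x. s \<in> {a..b} \<Longrightarrow> x \<in> closed_segment (rcis r a) (rcis r s) \<Longrightarrow> cmod (f x - c) \<le> D"
  shows "integral {a..b} (speed r) \<le> 4 * M * D"
proof -
  define l where "l s t = integral {s..t} (speed r)" for s t
  have comb: "l s t + l t u = l s u" if "s \<le> t" "t \<le> u" for s t u
    unfolding l_def using that r by (intro Henstock_Kurzweil_Integration.integral_combine speed_integrable) auto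
  have lpos: "0 < l s t" if "s < t" for s t unfolding l_def using integral_speed_pos[OF r that] .
  have l0: "l s s = 0" for s by (simp add: l_def)
  have lab: "l a b > 0" using lpos ab by simp
  have "continuous_on {a..b} (l a)" unfolding l_def
    using r by (intro indefinite_integral_continuous_1 speed_integrable) auto
  then obtain t where t: "a \<le> t" "t \<le> b" "l a t = l a b / 2"
    using IVT'[of "l a" a "l a b / 2" b] lab l0[of a] ab by auto
  have t1: "a < t" using t lab l0[of a] by (cases "t = a") auto
  have t2: "t < b" using t lab by (cases "t = b") auto
  have tot: "l a b \<le> l a (a + 2 * pi)"
    using comb[of a b "a + 2*pi"] lpos[of b "a + 2*pi"] l0[of b] ab by (cases "b = a + 2*pi") auto
  define z1 z2 where "z1 = rcis r a" and "z2 = rcis r t"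
  have zs: "z1 \<in> sphere 0 r" "z2 \<in> sphere 0 r" using r by (auto simp: z1_def z2_def)
  have eqD: "\<exists>n::int. u = v + 2 * pi * of_int n" if "f (rcis r u) = f (rcis r v)" for u v
  proof -
    have "rcis r u = rcis r v" using inj_onD[OF inj that] r by simp
    hence "cis u = cis v" using r by (simp add: rcis_def)
    thus ?thesis by (metis cis_eq_cis_obtain)
  qed
  have int01: "n = 0" if "- (2 * pi) < 2 * pi * of_int n" "2 * pi * of_int n < 2 * pi" for n :: int
  proof -
    have "2 * pi * (-1) < 2 * pi * of_int n" "2 * pi * of_int n < 2 * pi * 1" using that by auto
    from this[THEN mult_left_less_imp_less] have "-1 < (of_int n :: real)" "(of_int n :: real) < 1" by simp_all
    thus ?thesis by linarith
  qed
  have wne: "f z1 \<noteq> f z2"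
  proof
    assume "f z1 = f z2"
    then obtain n :: int where n: "t = a + 2 * pi * of_int n" using eqD[of t a] by (auto simp: z1_def z2_def)
    have "0 < 2 * pi * of_int n" "2 * pi * of_int n < 2 * pi" using n t1 t2 ab by linarith+
    hence "n = 0" using pi_gt_zero by (intro int01) linarith+
    thus False using n t1 by simp
  qed
  hence zne: "z1 \<noteq> z2" by auto
  have inner: "\<And>x. x \<in> closed_segment z1 z2 \<Longrightarrow> cmod (f x - c) \<le> D"
    using D[of t] t by (auto simp: z1_def z2_def)
  note id = internal_dist_bounds[OF r(2) zs zne inner]
  \<comment> \<open>The infimum runs over all parameter intervals whose ends map to the two points.
    Up to shifts by periods these are the one from \<open>a\<close> to \<open>t\<close>, of exactly
    half the length, and the one from \<open>t\<close> to \<open>a + 2 * pi\<close>, of at least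
    half the length by \<open>tot\<close>.\<close>
  have "l a b / 2 \<le> smaller_subarc_length f r (f z1) (f z2)"
    unfolding smaller_subarc_length_def
  proof (rule cInf_greatest)
    show "{circ_image_length f r s u |s u. s < u \<and> u < s + 2 * pi \<and> {f (rcis r s), f (rcis r u)} = {f z1, f z2}} \<noteq> {}"
    proof -
      have "a < t \<and> t < a + 2 * pi \<and> {f (rcis r a), f (rcis r t)} = {f z1, f z2}"
        using t1 t2 ab by (simp add: z1_def z2_def)
      thus ?thesis by blast
    qed
    fix x assume "x \<in> {circ_image_length f r s u |s u. s < u \<and> u < s + 2 * pi \<and> {f (rcis r s), f (rcis r u)} = {f z1, f z2}}"
    then obtain s u where su: "x = l s u" "s < u" "u < s + 2 * pi" "{f (rcis r s), f (rcis r u)} = {f z1, f z2}"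
      using circ_image_length_eq[of r] r by (auto simp: l_def)
    from su(4) consider "f (rcis r s) = f z1 \<and> f (rcis r u) = f z2" | "f (rcis r s) = f z2 \<and> f (rcis r u) = f z1"
      by (auto simp: doubleton_eq_iff)
    thus "l a b / 2 \<le> x"
    proof cases
      case 1
      then obtain m n :: int where mn: "s = a + 2 * pi * of_int m" "u = t + 2 * pi * of_int n"
        using eqD[of s a] eqD[of u t] by (auto simp: z1_def z2_def)
      have "u - s = t - a + 2 * pi * of_int (n - m)" by (simp add: mn algebra_simps)
      hence "n - m = 0" using su t1 t2 ab by (intro int01) linarith+
      hence "l s u = l a t" unfolding l_def mn using integral_speed_shift[of r a m t] r by simp
      thus ?thesis using su t by simp
    next
      case 2
      then obtain m n :: int where mn: "s = t + 2 * pi * of_int m" "u = a + 2 * pi * of_int n"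
        using eqD[of s t] eqD[of u a] by (auto simp: z1_def z2_def)
      \<comment> \<open>The complementary arc ends at \<open>a\<close> on the next turn:
        \<open>s < u < s + 2 * pi\<close> forces \<open>n = m + 1\<close>.\<close>
      have "u - s = a + 2 * pi - t + 2 * pi * of_int (n - m - 1)" by (simp add: mn algebra_simps)
      hence "n - m - 1 = 0" using su t1 t2 ab by (intro int01) linarith+
      hence "n = m + 1" by simp
      hence "u = a + 2 * pi + 2 * pi * of_int m" by (simp add: mn algebra_simps)
      hence "l s u = l t (a + 2 * pi)" unfolding l_def mn(1) using integral_speed_shift[of r t m "a + 2 * pi"] r by simp
      moreover have "l a t + l t (a + 2 * pi) = l a (a + 2 * pi)" using t1 t2 ab by (intro comb) auto
      ultimately show ?thesis using su t tot by simp
    qed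
  qed
  also have "\<dots> \<le> M * internal_dist (f ` ball 0 r) (f z1) (f z2)"
    using pommerenke[OF r, of "f z1" "f z2"] zs wne id(1) by (simp add: pos_divide_le_eq)
  also have "\<dots> \<le> M * (2 * D)" using id(2) pos by (intro mult_left_mono) auto
  finally show ?thesis by (simp add: l_def)
qed

text \<open>The arc lies within \<open>(1 + pi) * (1 - \<rho>)\<close> of
  \<open>rcis \<rho> \<theta>\<close>, with \<open>1 - \<rho>\<close> spent radially and
  \<open>pi * (1 - \<rho>)\<close> along the circle. \<open>local_oscillation\<close> confines the
  image to a disc, \<open>arc_length_le\<close> turns its radius into a length, and
  \<open>speed_lower\<close> with \<open>r \<ge> 1/2\<close> returns to the stretch at the price of
  \<open>2 * K\<close>.\<close>

lemma arc_integral_bound: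
  obtains C where "C > 0" "\<And>\<rho> r \<theta>. 0 \<le> \<rho> \<Longrightarrow> \<rho> \<le> r \<Longrightarrow> 1/2 \<le> r \<Longrightarrow> r < 1 \<Longrightarrow>
     integral {\<theta> - pi * (1 - \<rho>)..\<theta> + pi * (1 - \<rho>)} (\<lambda>t. stretch (rcis r t)) \<le> C * (1 - \<rho>) * stretch (rcis \<rho> \<theta>)"
proof -
  obtain C where C: "C > 0" "\<And>z w. z \<in> ball 0 1 \<Longrightarrow> w \<in> ball 0 1 \<Longrightarrow> cmod (w - z) \<le> (1 + pi) * (1 - cmod z) \<Longrightarrow>
     cmod (f w - f z) \<le> C * (1 - cmod z) * stretch z"
    using local_oscillation[of "1 + pi"] by (metis add_nonneg_nonneg pi_ge_zero zero_le_one)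
  have "integral {\<theta> - pi * (1 - \<rho>)..\<theta> + pi * (1 - \<rho>)} (\<lambda>t. stretch (rcis r t)) \<le> 2 * K * (4 * M * C) * (1 - \<rho>) * stretch (rcis \<rho> \<theta>)"
    if \<rho>: "0 \<le> \<rho>" "\<rho> \<le> r" and r: "1/2 \<le> r" "r < 1" for \<rho> r \<theta>
  proof -
    define z where "z = rcis \<rho> \<theta>"
    have z: "z \<in> ball 0 1" "cmod z = \<rho>" using \<rho> r by (auto simp: z_def)
    define a b where "a = \<theta> - pi * (1 - \<rho>)" and "b = \<theta> + pi * (1 - \<rho>)"
    \<comment> \<open>An intersection of discs, hence convex: it contains not only the arc but also
      the chords that \<open>arc_length_le\<close> asks about.\<close>
    define N where "N = ball 0 1 \<inter> cball z ((1 + pi) * (1 - \<rho>))"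
    have N: "rcis r t \<in> N" if t: "t \<in> {a..b}" for t
    proof -
      have "rcis r t - z = of_real (r - \<rho>) * cis t + of_real \<rho> * (cis t - cis \<theta>)"
        by (simp add: z_def rcis_def algebra_simps)
      hence "cmod (rcis r t - z) \<le> cmod (of_real (r - \<rho>) * cis t) + cmod (of_real \<rho> * (cis t - cis \<theta>))"
        using norm_triangle_ineq by metis
      also have "\<dots> = (r - \<rho>) + \<rho> * cmod (cis t - cis \<theta>)" using \<rho> by (simp add: norm_mult del: of_real_diff)
      also have "\<rho> * cmod (cis t - cis \<theta>) \<le> 1 * \<bar>t - \<theta>\<bar>"
        using \<rho> r norm_cis_diff_le by (intro mult_mono) auto
      also have "1 * \<bar>t - \<theta>\<bar> \<le> pi * (1 - \<rho>)" using t by (auto simp: a_def b_def)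
      finally have "cmod (rcis r t - z) \<le> (1 + pi) * (1 - \<rho>)" using r by (simp add: algebra_simps)
      thus ?thesis using r by (simp add: N_def dist_norm norm_minus_commute)
    qed
    have seg: "cmod (f x - f z) \<le> C * (1 - \<rho>) * stretch z"
      if "s \<in> {a..b}" "x \<in> closed_segment (rcis r a) (rcis r s)" for s x
    proof -
      have "closed_segment (rcis r a) (rcis r s) \<subseteq> N"
        using N[of a] N[OF that(1)] \<rho> r that(1) unfolding N_def
        by (intro closed_segment_subset convex_Int convex_ball convex_cball) auto
      hence "x \<in> N" using that(2) by blast
      thus ?thesis using C(2)[OF z(1), of x] z(2) by (simp add: N_def dist_norm norm_minus_commute)
    qed
    have "pi * (1 - \<rho>) \<le> pi * 1" using \<rho> by (intro mult_left_mono) auto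
    moreover have "pi * (1 - \<rho>) > 0" using \<rho> r by simp
    ultimately have "a < b" "b \<le> a + 2 * pi" by (auto simp: a_def b_def)
    from arc_length_le[OF _ r(2) this seg] r
    have len: "integral {a..b} (speed r) \<le> 4 * M * (C * (1 - \<rho>) * stretch z)" by simp
    have "integral {a..b} (\<lambda>t. stretch (rcis r t)) \<le> integral {a..b} (\<lambda>t. 2 * K * speed r t)"
    proof (intro integral_le integrable_continuous_real continuous_intros continuous_on_stretch_rcis continuous_on_speed)
      fix t
      have "1 / 2 / K * stretch (rcis r t) \<le> r / K * stretch (rcis r t)"
        using r K(1) stretch_bounds(3)[of "rcis r t"] by (intro mult_right_mono divide_right_mono) auto
      also have "\<dots> \<le> speed r t" using r by (intro speed_lower) auto
      finally show "stretch (rcis r t) \<le> 2 * K * speed r t" using K(1) by (simp add: field_simps)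
    qed (use r in auto)
    also have "\<dots> = 2 * K * integral {a..b} (speed r)" by simp
    also have "\<dots> \<le> 2 * K * (4 * M * (C * (1 - \<rho>) * stretch z))" using len K(1) by (intro mult_left_mono) auto
    finally show ?thesis by (simp only: a_def b_def z_def mult.assoc)
  qed
  moreover have "2 * K * (4 * M * C) > 0" using K(1) pos C(1) by simp
  ultimately show ?thesis using that by blast
qed

subsection \<open>Poisson integrals and boundary values of the stretch\<close>

text \<open>The weight gives \<open>4^-n\<close>, the window \<open>2^n\<close>, and the lower
  radial bound between the radii \<open>1 - x n\<close> and \<open>\<rho>\<close> gives
  \<open>2^(n * (1 - \<epsilon>))\<close>. Passing from \<delta>3 to \<epsilon> \<le> 1 keeps the
  exponent \<open>1 - \<epsilon>\<close> nonnegative, so that \<open>x n / d \<le> 2^n\<close> can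
  be inserted.\<close>

lemma stretch_dyadic:
  assumes \<rho>: "0 \<le> \<rho>" "\<rho> < 1"
  defines "x \<equiv> \<lambda>n. min (2^n * (1 - \<rho>)) 1" and "\<epsilon> \<equiv> min \<delta>3 1"
  shows "8 / (4^n * (1 - \<rho>)) * (x n * stretch (rcis (1 - x n) \<theta>)) \<le> 8 / C6 * stretch (rcis \<rho> \<theta>) * (2 powr (-\<epsilon>))^n"
proof -
  define d where "d = 1 - \<rho>"
  have d: "0 < d" "d \<le> 1" using \<rho> by (auto simp: d_def)
  have e: "0 < \<epsilon>" "\<epsilon> \<le> 1" "\<epsilon> \<le> \<delta>3" using pos by (auto simp: \<epsilon>_def)
  have "1 * d \<le> 2^n * d" using d by (intro mult_right_mono) auto
  hence x: "d \<le> x n" "x n \<le> 1" "x n \<le> 2^n * d" using d by (auto simp: x_def d_def)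
  hence y: "1 \<le> x n / d" "x n / d \<le> 2^n" using d by (auto simp: field_simps)
  define S T where "S = stretch (rcis \<rho> \<theta>)" and "T = stretch (rcis (1 - x n) \<theta>)"
  have T: "T > 0" using x d by (auto simp: T_def intro!: stretch_bounds(3))
  have S: "S > 0" using \<rho> by (auto simp: S_def intro!: stretch_bounds(3))
  have "C6 * (x n / d) powr (\<epsilon> - 1) * T \<le> C6 * (x n / d) powr (\<delta>3 - 1) * T"
    using y e T pos by (intro mult_right_mono mult_left_mono powr_mono) auto
  also have "\<dots> \<le> S"
    using radial_lower[of "cis \<theta>" "1 - x n" \<rho>] x \<rho> by (simp add: S_def T_def d_def rcis_def)
  finally have "C6 * (x n / d) powr (\<epsilon> - 1) * T \<le> S" .
  hence "(x n / d) powr (1 - \<epsilon>) * (C6 * (x n / d) powr (\<epsilon> - 1) * T) \<le> (x n / d) powr (1 - \<epsilon>) * S"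
    by (intro mult_left_mono) auto
  also have "(x n / d) powr (1 - \<epsilon>) * (C6 * (x n / d) powr (\<epsilon> - 1) * T) = C6 * T * ((x n / d) powr (1 - \<epsilon>) * (x n / d) powr (\<epsilon> - 1))"
    by (simp only: mult_ac)
  also have "(x n / d) powr (1 - \<epsilon>) * (x n / d) powr (\<epsilon> - 1) = 1"
    using x(1) d(1) by (simp flip: powr_add)
  also have "(x n / d) powr (1 - \<epsilon>) * S \<le> (2^n) powr (1 - \<epsilon>) * S"
    using y e S by (intro mult_right_mono powr_mono2) auto
  finally have TS: "T \<le> (2^n) powr (1 - \<epsilon>) * S / C6" using pos by (simp add: field_simps)
  have "8 / (4^n * d) * (x n * T) \<le> 8 / (4^n * d) * ((2^n * d) * ((2^n) powr (1 - \<epsilon>) * S / C6))"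
    using x d TS T by (intro mult_left_mono mult_mono) auto
  also have "\<dots> = 8 / C6 * S * (2^n / 4^n * (2^n) powr (1 - \<epsilon>))" using d by simp (simp only: mult_ac)
  also have "(2::real)^n / 4^n * (2^n) powr (1 - \<epsilon>) = (2 powr (-\<epsilon>))^n"
  proof -
    have "(2::real)^n / 4^n = (2^n) powr (-1)"
    proof -
      have "(4::real)^n = 2^n * 2^n" by (simp flip: power_mult_distrib)
      thus ?thesis by (simp add: powr_minus field_simps)
    qed
    hence "(2::real)^n / 4^n * (2^n) powr (1 - \<epsilon>) = (2^n) powr (-1 + (1 - \<epsilon>))" by (simp only: powr_add)
    also have "-1 + (1 - \<epsilon>) = -\<epsilon>" by simp
    finally have "(2::real)^n / 4^n * (2^n) powr (1 - \<epsilon>) = (2^n) powr (-\<epsilon>)" .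
    also have "\<dots> = (2 powr (-\<epsilon>))^n" by (simp add: powr_power powr_powr mult.commute flip: powr_realpow)
    finally show ?thesis .
  qed
  finally show ?thesis by (simp add: S_def T_def d_def)
qed

text \<open>The n-th window belongs to the box of height \<open>x n\<close> at
  \<open>rcis (1 - x n) \<theta>\<close>, a point on the same radius as
  \<open>rcis \<rho> \<theta>\<close>. So \<open>arc_integral_bound\<close> handles every window and
  the radial condition compares the resulting stretches. Once \<open>x n = 1\<close>, that point is
  the origin and the window a full period.\<close>

lemma poisson_window_bound:
  obtains C where "C > 0" "\<And>\<rho> r \<theta>. 0 \<le> \<rho> \<Longrightarrow> \<rho> \<le> r \<Longrightarrow> 1/2 \<le> r \<Longrightarrow> r < 1 \<Longrightarrow>
     (\<integral>\<^sup>+t\<in>{\<theta> - pi..\<theta> + pi}. ennreal (stretch (rcis r t)) * ennreal ((1 - \<rho>\<^sup>2) / (cmod (cis (t - \<theta>) - of_real \<rho>))\<^sup>2) \<partial>lborel)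
       \<le> ennreal (C * stretch (rcis \<rho> \<theta>))"
proof -
  obtain C where C: "C > 0" "\<And>\<rho> r \<theta>. 0 \<le> \<rho> \<Longrightarrow> \<rho> \<le> r \<Longrightarrow> 1/2 \<le> r \<Longrightarrow> r < 1 \<Longrightarrow>
     integral {\<theta> - pi * (1 - \<rho>)..\<theta> + pi * (1 - \<rho>)} (\<lambda>t. stretch (rcis r t)) \<le> C * (1 - \<rho>) * stretch (rcis \<rho> \<theta>)"
    using arc_integral_bound by blast
  define \<epsilon> where "\<epsilon> = min \<delta>3 1"
  define g where "g = (2::real) powr (-\<epsilon>)"
  have "\<epsilon> > 0" using pos by (simp add: \<epsilon>_def)
  hence g: "0 < g" "g < 1" using powr_less_mono[of "-\<epsilon>" 0 2] by (auto simp: g_def)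
  define C' where "C' = C * 8 / C6 * (1 / (1 - g))"
  have "(\<integral>\<^sup>+t\<in>{\<theta> - pi..\<theta> + pi}. ennreal (stretch (rcis r t)) * ennreal ((1 - \<rho>\<^sup>2) / (cmod (cis (t - \<theta>) - of_real \<rho>))\<^sup>2) \<partial>lborel)
       \<le> ennreal (C' * stretch (rcis \<rho> \<theta>))" (is "?I \<le> _")
    if \<rho>: "0 \<le> \<rho>" "\<rho> \<le> r" and r: "1/2 \<le> r" "r < 1" for \<rho> r \<theta>
  proof -
    have \<rho>1: "\<rho> < 1" using \<rho> r by simp
    define x where "x n = min (2^n * (1 - \<rho>)) 1" for n :: nat
    have x: "0 < x n" "x n \<le> 1" "1 - x n \<le> r" for n
    proof -
      have "1 * (1 - \<rho>) \<le> 2^n * (1 - \<rho>)" using \<rho>1 by (intro mult_right_mono) auto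
      hence "1 - \<rho> \<le> x n" using \<rho> by (simp only: x_def min.bounded_iff) simp
      thus "0 < x n" "1 - x n \<le> r" using \<rho> \<rho>1 by linarith+
      show "x n \<le> 1" by (simp add: x_def)
    qed
    have S: "stretch (rcis \<rho> \<theta>) > 0" using \<rho> \<rho>1 by (intro stretch_bounds) auto
    have rc: "continuous_on X (\<lambda>t. stretch (rcis r t))" for X using r by (intro continuous_on_stretch_rcis) auto
    have rpos: "0 \<le> stretch (rcis r t)" for t by (simp add: stretch_def)
    have meas: "(\<lambda>t. ennreal (stretch (rcis r t))) \<in> borel_measurable borel"
      using borel_measurable_continuous_onI[OF rc[of UNIV]] by measurable
    have "?I \<le> (\<Sum>n. ennreal (8 / (4^n * (1 - \<rho>))) * ennreal (C * x n * stretch (rcis (1 - x n) \<theta>)))"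
    proof (rule poisson_kernel_nn_integral[OF meas \<rho>(1) \<rho>1])
      fix n :: nat
      have "(\<integral>\<^sup>+t\<in>{\<theta> - pi * x n..\<theta> + pi * x n}. ennreal (stretch (rcis r t)) \<partial>lborel)
          = ennreal (integral {\<theta> - pi * x n..\<theta> + pi * x n} (\<lambda>t. stretch (rcis r t)))"
        by (rule nn_integral_Icc_continuous[OF rc rpos])
      also have "\<dots> \<le> ennreal (C * x n * stretch (rcis (1 - x n) \<theta>))"
        using C(2)[of "1 - x n" r \<theta>] x[of n] r by (intro ennreal_leI) simp
      finally show "(\<integral>\<^sup>+t\<in>{\<theta> - pi * min (2^n * (1 - \<rho>)) 1..\<theta> + pi * min (2^n * (1 - \<rho>)) 1}. ennreal (stretch (rcis r t)) \<partial>lborel)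
         \<le> ennreal (C * x n * stretch (rcis (1 - x n) \<theta>))" by (simp only: x_def)
    qed
    also have "\<dots> \<le> (\<Sum>n. ennreal (C * 8 / C6 * stretch (rcis \<rho> \<theta>) * g^n))"
    proof (intro suminf_le)
      fix n :: nat
      have "C * (8 / (4^n * (1 - \<rho>)) * (x n * stretch (rcis (1 - x n) \<theta>))) \<le> C * (8 / C6 * stretch (rcis \<rho> \<theta>) * g^n)"
        using stretch_dyadic[OF \<rho>(1) \<rho>1, of n \<theta>] C(1) unfolding x_def g_def \<epsilon>_def by (intro mult_left_mono) auto
      thus "ennreal (8 / (4^n * (1 - \<rho>))) * ennreal (C * x n * stretch (rcis (1 - x n) \<theta>)) \<le> ennreal (C * 8 / C6 * stretch (rcis \<rho> \<theta>) * g^n)"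
        using \<rho>1 by (subst ennreal_mult'[symmetric]) (auto intro!: ennreal_leI simp: mult_ac)
    qed auto
    also have "\<dots> = ennreal (C * 8 / C6 * stretch (rcis \<rho> \<theta>) * (1 / (1 - g)))"
      using C(1) pos S g by (intro suminf_ennreal_eq sums_mult geometric_sums) auto
    also have "C * 8 / C6 * stretch (rcis \<rho> \<theta>) * (1 / (1 - g)) = C' * stretch (rcis \<rho> \<theta>)" by (simp add: C'_def mult_ac)
    finally show ?thesis .
  qed
  moreover have "C' > 0" using C(1) pos g by (simp add: C'_def)
  ultimately show ?thesis using that by blast
qed

text \<open>A rotation moves the centre of the window to the argument of \<open>\<zeta>\<close>. By
  periodicity the windows around \<open>\<theta> - 2 * pi\<close>, \<open>\<theta>\<close> and
  \<open>\<theta> + 2 * pi\<close> obey the same bound, and together they cover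
  \<open>{0..2*pi}\<close>; hence the factor 3.\<close>

lemma poisson_stretch_bound:
  obtains C where "C > 0" "\<And>\<zeta> r. cmod \<zeta> \<le> r \<Longrightarrow> 1/2 \<le> r \<Longrightarrow> r < 1 \<Longrightarrow>
     (\<integral>\<^sup>+t\<in>{0..2*pi}. ennreal (stretch (rcis r t)) * ennreal ((1 - (cmod \<zeta>)\<^sup>2) / (cmod (cis t - \<zeta>))\<^sup>2) \<partial>lborel)
       \<le> ennreal (C * stretch \<zeta>)"
proof -
  obtain C where C: "C > 0" "\<And>\<rho> r \<theta>. 0 \<le> \<rho> \<Longrightarrow> \<rho> \<le> r \<Longrightarrow> 1/2 \<le> r \<Longrightarrow> r < 1 \<Longrightarrow>
     (\<integral>\<^sup>+t\<in>{\<theta> - pi..\<theta> + pi}. ennreal (stretch (rcis r t)) * ennreal ((1 - \<rho>\<^sup>2) / (cmod (cis (t - \<theta>) - of_real \<rho>))\<^sup>2) \<partial>lborel)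
       \<le> ennreal (C * stretch (rcis \<rho> \<theta>))"
    using poisson_window_bound by blast
  have "(\<integral>\<^sup>+t\<in>{0..2*pi}. ennreal (stretch (rcis r t)) * ennreal ((1 - (cmod \<zeta>)\<^sup>2) / (cmod (cis t - \<zeta>))\<^sup>2) \<partial>lborel)
       \<le> ennreal (3 * C * stretch \<zeta>)" if \<zeta>: "cmod \<zeta> \<le> r" and r: "1/2 \<le> r" "r < 1" for \<zeta> r
  proof -
    define \<theta> where "\<theta> = Arg2pi \<zeta>"
    have \<theta>: "0 \<le> \<theta>" "\<theta> < 2 * pi" "\<zeta> = rcis (cmod \<zeta>) \<theta>"
      using Arg2pi[of \<zeta>] by (auto simp: \<theta>_def is_Arg_def rcis_def cis_conv_exp)
    define v where "v t = ennreal (stretch (rcis r t)) * ennreal ((1 - (cmod \<zeta>)\<^sup>2) / (cmod (cis t - \<zeta>))\<^sup>2)" for t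
    have [measurable]: "v \<in> borel_measurable borel"
    proof -
      have "(\<lambda>t. stretch (rcis r t)) \<in> borel_measurable borel"
        using r by (intro borel_measurable_continuous_onI continuous_on_stretch_rcis) auto
      moreover have "(\<lambda>t. cmod (cis t - \<zeta>)) \<in> borel_measurable borel"
        by (intro borel_measurable_continuous_onI continuous_intros)
      ultimately show ?thesis unfolding v_def[abs_def] by measurable
    qed
    have win: "(\<integral>\<^sup>+t\<in>{\<theta> + 2 * pi * of_int j - pi..\<theta> + 2 * pi * of_int j + pi}. v t \<partial>lborel) \<le> ennreal (C * stretch \<zeta>)" for j :: int
    proof -
      have rc: "rcis (cmod \<zeta>) (\<theta> + 2 * pi * of_int j) = \<zeta>"
        using cis_multiple_2pi[of "of_int j"] by (subst (2) \<theta>(3)) (simp add: rcis_def flip: cis_mult)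
      have "cmod (cis (t - (\<theta> + 2 * pi * of_int j)) - of_real (cmod \<zeta>)) = cmod (cis t - \<zeta>)" for t
      proof -
        have "cis t - \<zeta> = cis (\<theta> + 2 * pi * of_int j) * (cis (t - (\<theta> + 2 * pi * of_int j)) - of_real (cmod \<zeta>))"
          by (subst rc[symmetric]) (simp add: right_diff_distrib cis_mult rcis_def)
        thus ?thesis by (simp add: norm_mult)
      qed
      with C(2)[of "cmod \<zeta>" r "\<theta> + 2 * pi * of_int j"] \<zeta> r show ?thesis by (simp add: v_def rc)
    qed
    have "v t * indicator {0..2*pi} t \<le> (\<Sum>j\<in>{-1,0,1::int}. v t * indicator {\<theta> + 2 * pi * of_int j - pi..\<theta> + 2 * pi * of_int j + pi} t)" for t
    proof (cases "t \<in> {0..2*pi}")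
      case True
      have "\<exists>j\<in>{-1,0,1::int}. t \<in> {\<theta> + 2 * pi * of_int j - pi..\<theta> + 2 * pi * of_int j + pi}"
        using True \<theta> by (cases "t < \<theta> - pi"; cases "t > \<theta> + pi") auto
      then obtain j where j: "j \<in> {-1,0,1::int}" "t \<in> {\<theta> + 2 * pi * of_int j - pi..\<theta> + 2 * pi * of_int j + pi}" by blast
      have "v t * indicator {0..2*pi} t \<le> (\<Sum>j\<in>{j}. v t * indicator {\<theta> + 2 * pi * of_int j - pi..\<theta> + 2 * pi * of_int j + pi} t)"
        using j(2) True by simp
      also have "\<dots> \<le> (\<Sum>j\<in>{-1,0,1::int}. v t * indicator {\<theta> + 2 * pi * of_int j - pi..\<theta> + 2 * pi * of_int j + pi} t)"
        using j(1) by (intro sum_mono2) auto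
      finally show ?thesis .
    qed simp
    hence "(\<integral>\<^sup>+t\<in>{0..2*pi}. v t \<partial>lborel) \<le> (\<integral>\<^sup>+t. (\<Sum>j\<in>{-1,0,1::int}. v t * indicator {\<theta> + 2 * pi * of_int j - pi..\<theta> + 2 * pi * of_int j + pi} t) \<partial>lborel)"
      by (intro nn_integral_mono)
    also have "\<dots> = (\<Sum>j\<in>{-1,0,1::int}. \<integral>\<^sup>+t\<in>{\<theta> + 2 * pi * of_int j - pi..\<theta> + 2 * pi * of_int j + pi}. v t \<partial>lborel)"
      by (rule nn_integral_sum) measurable
    also have "\<dots> \<le> (\<Sum>j\<in>{-1,0,1::int}. ennreal (C * stretch \<zeta>))" by (intro sum_mono win)
    also have "\<dots> = ennreal (3 * C * stretch \<zeta>)"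
      using C(1) stretch_bounds(3)[of \<zeta>] \<zeta> r by (simp add: ennreal_mult' mult.assoc)
    finally show ?thesis by (simp add: v_def)
  qed
  thus ?thesis using that[of "3 * C"] C(1) by simp
qed

text \<open>With \<open>p\<close> the square of \<open>F\<close> and
  \<open>\<omega> = q / p\<close>, the stretch equals
  \<open>(cmod F)\<^sup>2 * (1 + cmod \<omega>)\<close>, a continuous expression in two functions
  with radial limits almost everywhere.\<close>

lemma stretch_radial_limit:
  "AE t in lborel. t \<in> {0..2*pi} \<longrightarrow> (\<exists>L. ((\<lambda>r. stretch (rcis r t)) \<longlongrightarrow> L) (at_left 1))"
proof -
  obtain F where F: "F holomorphic_on ball 0 1" "\<And>z. z \<in> ball 0 1 \<Longrightarrow> p z = (F z)\<^sup>2"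
    using contractible_imp_holomorphic_sqrt[OF hol(1) convex_imp_contractible[OF convex_ball] p_nz] by blast
  obtain C where C: "C > 0" "\<And>\<rho> r \<theta>. 0 \<le> \<rho> \<Longrightarrow> \<rho> \<le> r \<Longrightarrow> 1/2 \<le> r \<Longrightarrow> r < 1 \<Longrightarrow>
     integral {\<theta> - pi * (1 - \<rho>)..\<theta> + pi * (1 - \<rho>)} (\<lambda>t. stretch (rcis r t)) \<le> C * (1 - \<rho>) * stretch (rcis \<rho> \<theta>)"
    using arc_integral_bound by blast
  have "cball 0 (1/2) \<subseteq> (ball 0 1 :: complex set)" by auto
  \<comment> \<open>\<open>arc_integral_bound\<close> starts at radius \<open>1/2\<close>; smaller
    circles are covered by compactness.\<close>
  then obtain zm where zm: "\<And>z. z \<in> cball 0 (1/2) \<Longrightarrow> stretch z \<le> stretch zm"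
    using continuous_attains_sup[OF compact_cball[of 0 "1/2::real"] _ continuous_on_subset[OF stretch_continuous]]
    by (metis cball_eq_empty not_less half_gt_zero_iff zero_less_one order_less_imp_le)
  have sc: "continuous_on X (\<lambda>t. stretch (rcis R t))" if "0 < R" "R < 1" for R X
    using that by (intro continuous_on_stretch_rcis) auto
  have bd: "integral {-pi..3*pi} (\<lambda>t. (cmod (F (of_real R * cis t)))\<^sup>2) \<le> 2 * C * stretch 0 + 4 * pi * stretch zm"
    if R: "0 < R" "R < 1" for R
  proof -
    have "integral {-pi..3*pi} (\<lambda>t. (cmod (F (of_real R * cis t)))\<^sup>2) \<le> integral {-pi..3*pi} (\<lambda>t. stretch (rcis R t))"
    proof (intro integral_le integrable_continuous_real sc R continuous_intros)
      show "continuous_on {-pi..3*pi} (\<lambda>t. F (of_real R * cis t))"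
        by (rule continuous_on_compose2[OF holomorphic_on_imp_continuous_on[OF F(1)]])
           (use R in \<open>auto intro!: continuous_intros simp: norm_mult\<close>)
      fix t
      have "rcis R t \<in> ball 0 1" using R by simp
      hence "cmod ((F (rcis R t))\<^sup>2) \<le> stretch (rcis R t)" using stretch_bounds(1) F(2) by metis
      thus "(cmod (F (of_real R * cis t)))\<^sup>2 \<le> stretch (rcis R t)" by (simp add: rcis_def norm_power)
    qed
    also have "\<dots> \<le> 2 * C * stretch 0 + 4 * pi * stretch zm"
    proof (cases "R \<ge> 1/2")
      case True
      have "integral {-pi..3*pi} (\<lambda>t. stretch (rcis R t)) = integral {-pi..pi} (\<lambda>t. stretch (rcis R t)) + integral {pi..3*pi} (\<lambda>t. stretch (rcis R t))"
        by (rule Henstock_Kurzweil_Integration.integral_combine[symmetric]) (auto intro!: integrable_continuous_real sc R)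
      \<comment> \<open>The case \<open>\<rho> = 0\<close> with the centres \<open>0\<close> and
        \<open>2*pi\<close>: two full-period windows make up the interval.\<close>
      also have "\<dots> \<le> C * stretch 0 + C * stretch 0"
        using C(2)[of 0 R 0] C(2)[of 0 R "2*pi"] True R by (intro add_mono) auto
      also have "\<dots> \<le> 2 * C * stretch 0 + 4 * pi * stretch zm" by (simp add: stretch_def)
      finally show ?thesis .
    next
      case False
      have "integral {-pi..3*pi} (\<lambda>t. stretch (rcis R t)) \<le> integral {-pi..3*pi} (\<lambda>t. stretch zm)"
        using False R zm by (intro integral_le integrable_continuous_real sc R) auto
      also have "\<dots> = 4 * pi * stretch zm" by simp
      also have "\<dots> \<le> 2 * C * stretch 0 + 4 * pi * stretch zm" using C(1) by (simp add: stretch_def)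
      finally show ?thesis .
    qed
    finally show ?thesis .
  qed
  have AEF: "AE t in lborel. t \<in> {0..2*pi} \<longrightarrow> (\<exists>L. ((\<lambda>r. F (of_real r * cis t)) \<longlongrightarrow> L) (at_left 1))"
    by (rule H2_radial_limit[OF F(1) bd])
  define \<omega> where "\<omega> z = q z / p z" for z
  have \<omega>h: "\<omega> holomorphic_on ball 0 1" unfolding \<omega>_def using p_nz hol by (intro holomorphic_intros) auto
  have \<omega>1: "cmod (\<omega> z) \<le> 1" if "z \<in> ball 0 1" for z
    using dom[OF that] p_nz[OF that] by (simp add: \<omega>_def norm_divide)
  have "integral {-pi..3*pi} (\<lambda>t. (cmod (\<omega> (of_real R * cis t)))\<^sup>2) \<le> 4 * pi" if R: "0 < R" "R < 1" for R
  proof -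
    have "integral {-pi..3*pi} (\<lambda>t. (cmod (\<omega> (of_real R * cis t)))\<^sup>2) \<le> integral {-pi..3*pi} (\<lambda>t. 1)"
    proof (intro integral_le integrable_continuous_real continuous_intros)
      show "continuous_on {-pi..3*pi} (\<lambda>t. \<omega> (of_real R * cis t))"
        by (rule continuous_on_compose2[OF holomorphic_on_imp_continuous_on[OF \<omega>h]])
           (use R in \<open>auto intro!: continuous_intros simp: norm_mult\<close>)
      fix t
      show "(cmod (\<omega> (of_real R * cis t)))\<^sup>2 \<le> 1"
        using \<omega>1[of "of_real R * cis t"] R by (simp add: norm_mult power_le_one)
    qed
    thus ?thesis by simp
  qed
  hence AE\<omega>: "AE t in lborel. t \<in> {0..2*pi} \<longrightarrow> (\<exists>L. ((\<lambda>r. \<omega> (of_real r * cis t)) \<longlongrightarrow> L) (at_left 1))"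
    by (rule H2_radial_limit[OF \<omega>h])
  show ?thesis using AEF AE\<omega>
  proof eventually_elim
    case (elim t)
    show ?case
    proof
      assume t: "t \<in> {0..2*pi}"
      obtain L L' where L: "((\<lambda>r. F (of_real r * cis t)) \<longlongrightarrow> L) (at_left 1)" "((\<lambda>r. \<omega> (of_real r * cis t)) \<longlongrightarrow> L') (at_left 1)"
        using elim t by blast
      have "((\<lambda>r. (cmod (F (of_real r * cis t)))\<^sup>2 * (1 + cmod (\<omega> (of_real r * cis t)))) \<longlongrightarrow> (cmod L)\<^sup>2 * (1 + cmod L')) (at_left 1)"
        by (intro tendsto_intros L)
      moreover have "eventually (\<lambda>r. r \<in> {0<..<1}) (at_left (1::real))"
        by (rule eventually_at_leftI[of 0]) auto
      hence "eventually (\<lambda>r. (cmod (F (of_real r * cis t)))\<^sup>2 * (1 + cmod (\<omega> (of_real r * cis t))) = stretch (rcis r t)) (at_left 1)"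
      proof eventually_elim
        case (elim r)
        hence z: "rcis r t \<in> ball 0 1" by simp
        have "(cmod (F (rcis r t)))\<^sup>2 * (1 + cmod (\<omega> (rcis r t))) = stretch (rcis r t)"
          using F(2)[OF z] p_nz[OF z] by (simp add: stretch_def \<omega>_def norm_divide norm_power field_simps)
        thus ?case by (simp add: rcis_def)
      qed
      ultimately have "((\<lambda>r. stretch (rcis r t)) \<longlongrightarrow> (cmod L)\<^sup>2 * (1 + cmod L')) (at_left 1)"
        by (rule Lim_transform_eventually)
      thus "\<exists>L. ((\<lambda>r. stretch (rcis r t)) \<longlongrightarrow> L) (at_left 1)" ..
    qed
  qed
qed

end

context harmonic_disc_map
begin

text \<open>Almost everywhere the integrand is the limit of the \<open>u k\<close>, in which the
  stretch is taken at radius \<open>\<rho> k\<close> and the kernel stays on the unit circle; it is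
  replaced by their \<open>liminf\<close> for Fatou's lemma. For fixed \<open>\<zeta>\<close> almost
  all \<open>\<rho> k\<close> exceed \<open>cmod \<zeta>\<close> and \<open>1/2\<close>, and the
  bound \<open>C / (2 * pi)\<close> depends on neither \<open>k\<close> nor
  \<open>\<zeta>\<close>.\<close>

lemma poisson_bdry_bound:
  assumes N: "\<And>z. z \<in> ball 0 1 \<Longrightarrow> norm_D f z = stretch z"
  obtains C where "\<And>\<zeta>. \<zeta> \<in> ball 0 1 \<Longrightarrow>
     (\<integral>\<^sup>+\<theta>\<in>{0..2 * pi}. ennreal (1 / (2 * pi) * (norm_D_bdry f (cis \<theta>) / norm_D f \<zeta>)
        * ((1 - (cmod \<zeta>)\<^sup>2) / (cmod (cis \<theta> - \<zeta>))\<^sup>2)) \<partial>lborel) \<le> ennreal C"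
proof -
  obtain C where C: "C > 0" "\<And>\<zeta> r. cmod \<zeta> \<le> r \<Longrightarrow> 1/2 \<le> r \<Longrightarrow> r < 1 \<Longrightarrow>
     (\<integral>\<^sup>+t\<in>{0..2*pi}. ennreal (stretch (rcis r t)) * ennreal ((1 - (cmod \<zeta>)\<^sup>2) / (cmod (cis t - \<zeta>))\<^sup>2) \<partial>lborel)
       \<le> ennreal (C * stretch \<zeta>)"
    using poisson_stretch_bound by blast
  define \<rho> where "\<rho> k = 1 - 1 / (real k + 2)" for k
  have \<rho>: "0 < \<rho> k" "\<rho> k < 1" for k by (auto simp: \<rho>_def field_simps)
  have \<rho>1: "\<rho> \<longlonglongrightarrow> 1" unfolding \<rho>_def by real_asymp
  hence \<rho>_left: "filterlim \<rho> (at_left 1) sequentially"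
    using \<rho> less_imp_neq[OF \<rho>(2)] by (auto simp: filterlim_at intro!: always_eventually)
  have "(\<integral>\<^sup>+\<theta>\<in>{0..2 * pi}. ennreal (1 / (2 * pi) * (norm_D_bdry f (cis \<theta>) / norm_D f \<zeta>)
        * ((1 - (cmod \<zeta>)\<^sup>2) / (cmod (cis \<theta> - \<zeta>))\<^sup>2)) \<partial>lborel) \<le> ennreal (C / (2 * pi))"
    if \<zeta>: "\<zeta> \<in> ball 0 1" for \<zeta>
  proof -
    define S where "S = stretch \<zeta>"
    have S: "S > 0" using stretch_bounds(3)[OF \<zeta>] by (simp add: S_def)
    define P where "P t = (1 - (cmod \<zeta>)\<^sup>2) / (cmod (cis t - \<zeta>))\<^sup>2" for t
    have P0: "P t \<ge> 0" for t using \<zeta> by (simp add: P_def power_le_one)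
    define u where "u k t = ennreal (1 / (2*pi) * (stretch (rcis (\<rho> k) t) / S) * P t) * indicator {0..2*pi} t" for k t
    have [measurable]: "P \<in> borel_measurable borel"
    proof -
      have "(\<lambda>t. cmod (cis t - \<zeta>)) \<in> borel_measurable borel"
        by (intro borel_measurable_continuous_onI continuous_intros)
      thus ?thesis unfolding P_def[abs_def] by measurable
    qed
    have [measurable]: "(\<lambda>t. stretch (rcis (\<rho> k) t)) \<in> borel_measurable borel" for k
      using \<rho>[of k] by (intro borel_measurable_continuous_onI continuous_on_stretch_rcis) auto
    have um: "u k \<in> borel_measurable lborel" for k unfolding u_def[abs_def] by measurable
    have "AE t in lborel. ennreal (1 / (2 * pi) * (norm_D_bdry f (cis t) / norm_D f \<zeta>) * P t) * indicator {0..2*pi} t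
        = liminf (\<lambda>k. u k t)"
      using stretch_radial_limit
    proof eventually_elim
      case (elim t)
      show ?case
      proof (cases "t \<in> {0..2*pi}")
        case False
        thus ?thesis by (simp add: u_def Liminf_const)
      next
        case True
        then obtain L where L: "((\<lambda>r. stretch (rcis r t)) \<longlongrightarrow> L) (at_left 1)" using elim by blast
        have "eventually (\<lambda>r. r \<in> {0<..<1}) (at_left (1::real))"
          by (rule eventually_at_leftI[of 0]) auto
        hence "eventually (\<lambda>r. stretch (rcis r t) = norm_D f (of_real r * cis t)) (at_left 1)"
        proof eventually_elim
          case (elim r)
          thus ?case using N[of "rcis r t"] by (simp add: rcis_def norm_mult)
        qed
        with L have "((\<lambda>r. norm_D f (of_real r * cis t)) \<longlongrightarrow> L) (at_left 1)"
          by (rule Lim_transform_eventually)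
        hence bdry: "norm_D_bdry f (cis t) = L"
          unfolding norm_D_bdry_def by (intro tendsto_Lim) auto
        have "(\<lambda>k. stretch (rcis (\<rho> k) t)) \<longlonglongrightarrow> L" using filterlim_compose[OF L \<rho>_left] .
        hence "(\<lambda>k. 1 / (2*pi) * (stretch (rcis (\<rho> k) t) / S) * P t) \<longlonglongrightarrow> 1 / (2*pi) * (L / S) * P t"
          using S by (intro tendsto_intros) auto
        hence "(\<lambda>k. ennreal (1 / (2*pi) * (stretch (rcis (\<rho> k) t) / S) * P t)) \<longlonglongrightarrow> ennreal (1 / (2*pi) * (L / S) * P t)"
          by (rule tendsto_ennrealI)
        hence "(\<lambda>k. u k t) \<longlonglongrightarrow> ennreal (1 / (2*pi) * (L / S) * P t)" using True by (simp add: u_def)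
        hence "liminf (\<lambda>k. u k t) = ennreal (1 / (2*pi) * (L / S) * P t)" by (intro lim_imp_Liminf) auto
        thus ?thesis using True bdry N[OF \<zeta>] by (simp add: S_def)
      qed
    qed
    hence "(\<integral>\<^sup>+t\<in>{0..2 * pi}. ennreal (1 / (2 * pi) * (norm_D_bdry f (cis t) / norm_D f \<zeta>) * P t) \<partial>lborel)
        = (\<integral>\<^sup>+t. liminf (\<lambda>k. u k t) \<partial>lborel)"
      by (rule nn_integral_cong_AE)
    also have "\<dots> \<le> liminf (\<lambda>k. \<integral>\<^sup>+t. u k t \<partial>lborel)" by (rule nn_integral_liminf[OF um])
    also have "\<dots> \<le> ennreal (C / (2 * pi))"
    proof (rule Liminf_le)
      have "eventually (\<lambda>k. max (cmod \<zeta>) (1/2) < \<rho> k) sequentially"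
        using \<zeta> by (intro order_tendstoD(1)[OF \<rho>1]) auto
      thus "eventually (\<lambda>k. (\<integral>\<^sup>+t. u k t \<partial>lborel) \<le> ennreal (C / (2 * pi))) sequentially"
      proof eventually_elim
        case (elim k)
        have "(\<integral>\<^sup>+t. u k t \<partial>lborel) = (\<integral>\<^sup>+t. ennreal (1 / (2*pi*S)) * (ennreal (stretch (rcis (\<rho> k) t)) * ennreal (P t) * indicator {0..2*pi} t) \<partial>lborel)"
        proof (intro nn_integral_cong)
          fix t
          have eq: "1 / (2*pi) * (stretch (rcis (\<rho> k) t) / S) * P t = 1 / (2*pi*S) * (stretch (rcis (\<rho> k) t) * P t)" by simp
          show "u k t = ennreal (1 / (2*pi*S)) * (ennreal (stretch (rcis (\<rho> k) t)) * ennreal (P t) * indicator {0..2*pi} t)"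
          proof -
            have "ennreal (a * (b * c)) = ennreal a * (ennreal b * ennreal c)" if "0 \<le> a" "0 \<le> b" "0 \<le> c" for a b c
              using that by (simp add: ennreal_mult)
            from this[of "1 / (2*pi*S)" "stretch (rcis (\<rho> k) t)" "P t"]
            have e: "ennreal (1 / (2*pi*S) * (stretch (rcis (\<rho> k) t) * P t)) = ennreal (1 / (2*pi*S)) * (ennreal (stretch (rcis (\<rho> k) t)) * ennreal (P t))"
              using S P0[of t] by (simp add: stretch_def)
            show ?thesis unfolding u_def eq e by (simp only: mult.assoc)
          qed
        qed
        also have "\<dots> = ennreal (1 / (2*pi*S)) * (\<integral>\<^sup>+t\<in>{0..2*pi}. ennreal (stretch (rcis (\<rho> k) t)) * ennreal (P t) \<partial>lborel)"
          by (rule nn_integral_cmult) measurable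
        also have "\<dots> \<le> ennreal (1 / (2*pi*S)) * ennreal (C * S)"
          unfolding P_def S_def using C(2)[of \<zeta> "\<rho> k"] elim \<rho>[of k] by (intro mult_left_mono) auto
        also have "\<dots> = ennreal (C / (2 * pi))" using S C(1) by (simp flip: ennreal_mult)
        finally show ?case .
      qed
    qed simp
    finally show ?thesis by (simp only: P_def)
  qed
  thus ?thesis using that by blast
qed

end

section \<open>The main theorem\<close>

text \<open>The set where \<open>\<phi>\<close> is negative is open and null, hence empty. This
  extends the dilatation inequality, imposed almost everywhere, to all points of the disc.\<close>

lemma AE_nonneg_imp_nonneg:
  fixes \<phi> :: "complex \<Rightarrow> real"
  assumes "open U" "continuous_on U \<phi>" and AE: "AE z\<in>U in lborel. 0 \<le> \<phi> z" and z: "z \<in> U"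
  shows "0 \<le> \<phi> z"
proof (rule ccontr)
  assume "\<not> 0 \<le> \<phi> z"
  define V where "V = U \<inter> \<phi> -` {..<0}"
  have V: "open V" "z \<in> V" using assms(1,2) z \<open>\<not> 0 \<le> \<phi> z\<close>
    by (auto simp: V_def intro: continuous_open_preimage)
  then obtain e where e: "e > 0" "ball z e \<subseteq> V" by (meson openE)
  have "AE x in lborel. x \<notin> ball z e" using AE by eventually_elim (use e(2) in \<open>auto simp: V_def\<close>)
  hence "ball z e \<in> null_sets lborel" by (simp add: AE_iff_null_sets)
  hence "measure lborel (ball z e) = 0" by (simp add: null_sets_def measure_def)
  thus False using content_ball_pos[OF e(1), of z] by simp
qed

lemma norm_D_harmonic:
  assumes "h holomorphic_on ball 0 1" "g holomorphic_on ball 0 1"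
    and eq: "\<And>z. z \<in> ball 0 1 \<Longrightarrow> f z = h z + cnj (g z)" and z: "z \<in> ball 0 1"
  shows "(f has_derivative (\<lambda>v. deriv h z * v + cnj (deriv g z * v))) (at z)"
    and "wirt_dz f z = deriv h z" and "wirt_dzbar f z = cnj (deriv g z)"
proof -
  have "(h has_derivative (\<lambda>v. deriv h z * v)) (at z)" "(g has_derivative (\<lambda>v. deriv g z * v)) (at z)"
    using holomorphic_derivI[OF _ open_ball z] assms(1,2) by (auto simp: has_field_derivative_def)
  hence "((\<lambda>w. h w + cnj (g w)) has_derivative (\<lambda>v. deriv h z * v + cnj (deriv g z * v))) (at z)"
    by (intro has_derivative_add has_derivative_cnj)
  thus *: "(f has_derivative (\<lambda>v. deriv h z * v + cnj (deriv g z * v))) (at z)"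
    by (rule has_derivative_transform_within_open[OF _ open_ball z]) (simp add: eq)
  have "frechet_derivative f (at z) = (\<lambda>v. deriv h z * v + cnj (deriv g z * v))"
    using frechet_derivative_at[OF *] by simp
  thus "wirt_dz f z = deriv h z" "wirt_dzbar f z = cnj (deriv g z)"
    by (simp_all add: wirt_dz_def wirt_dzbar_def algebra_simps)
qed

theorem theorem6:
  fixes K C6 C7 \<delta>3 \<delta>4 :: real and f :: "complex \<Rightarrow> complex" and G :: "complex set"
  assumes "K \<ge> 1"
    and "f \<in> S_HK K G"
    and "bounded_pommerenke_interior_domain K f G"
    and "C6 > 0" and "C7 > 0" and "\<delta>3 > 0" and "0 < \<delta>4" and "\<delta>4 < 1"
    and "\<And>\<zeta> \<rho>1 \<rho>2. \<zeta> \<in> sphere 0 1 \<Longrightarrow> 0 \<le> \<rho>1 \<Longrightarrow> \<rho>1 \<le> \<rho>2 \<Longrightarrow> \<rho>2 < 1 \<Longrightarrow>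
           C6 * ((1 - \<rho>1) / (1 - \<rho>2)) powr (\<delta>3 - 1) * norm_D f (of_real \<rho>1 * \<zeta>)
             \<le> norm_D f (of_real \<rho>2 * \<zeta>) \<and>
           norm_D f (of_real \<rho>2 * \<zeta>)
             \<le> C7 * ((1 - \<rho>2) / (1 - \<rho>1)) powr (\<delta>4 - 1) * norm_D f (of_real \<rho>1 * \<zeta>)"
  shows "(SUP \<zeta>\<in>ball 0 1.
            \<integral>\<^sup>+\<theta>\<in>{0..2 * pi}.
              ennreal (1 / (2 * pi) * (norm_D_bdry f (cis \<theta>) / norm_D f \<zeta>)
                       * ((1 - (cmod \<zeta>)\<^sup>2) / (cmod (cis \<theta> - \<zeta>))\<^sup>2))
            \<partial>lborel) < \<infinity>"
proof -
  note radial = assms(9)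
  have fS: "f \<in> S_H" and qc: "quasiconformal K f (ball 0 1) G" using assms(2) by (auto simp: S_HK_def)
  obtain h g where hg: "h holomorphic_on ball 0 1" "g holomorphic_on ball 0 1" "deriv h 0 = 1"
      "\<And>z. z \<in> ball 0 1 \<Longrightarrow> f z = h z + cnj (g z)" and inj: "inj_on f (ball 0 1)"
    using fS unfolding S_H_def by blast
  define hd gd where "hd = deriv h" and "gd = deriv g"
  have hol: "hd holomorphic_on ball 0 1" "gd holomorphic_on ball 0 1"
    using hg(1,2) by (auto simp: hd_def gd_def intro!: holomorphic_deriv)
  have cont: "continuous_on (ball 0 1) hd" "continuous_on (ball 0 1) gd"
    using hol by (auto intro: holomorphic_on_imp_continuous_on)
  note W = norm_D_harmonic[OF hg(1,2,4)]
  have N: "norm_D f z = cmod (hd z) + cmod (gd z)" if "z \<in> ball 0 1" for z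
    using W(2,3)[OF _ that] by (simp add: norm_D_def hd_def gd_def)
  \<comment> \<open>The lower radial bound carries \<open>norm_D f 0 \<ge> 1\<close> outwards along
    each radius. Positivity permits the cancellation in \<open>dil\<close> and, through
    \<open>ne\<close>, leads to strict domination.\<close>
  have pos: "norm_D f z > 0" if z: "z \<in> ball 0 1" for z
  proof -
    define \<zeta> where "\<zeta> = (if z = 0 then 1 else z / of_real (cmod z))"
    have \<zeta>: "\<zeta> \<in> sphere 0 1" "of_real (cmod z) * \<zeta> = z" by (auto simp: \<zeta>_def norm_divide)
    have "norm_D f 0 \<ge> 1" using N[of 0] hg(3) by (simp add: hd_def)
    hence "0 < C6 * ((1 - 0) / (1 - cmod z)) powr (\<delta>3 - 1) * norm_D f (of_real 0 * \<zeta>)"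
      using assms(4) z by simp
    also have "\<dots> \<le> norm_D f z" using radial[OF \<zeta>(1), of 0 "cmod z"] \<zeta>(2) z by simp
    finally show ?thesis .
  qed
  \<comment> \<open>The absolute value remains as long as it is undecided which part dominates. The
    inequality extends to every point by continuity, and one factor \<open>norm_D f z\<close>
    cancels.\<close>
  have dil: "cmod (hd z) + cmod (gd z) \<le> K * \<bar>cmod (hd z) - cmod (gd z)\<bar>" if z: "z \<in> ball 0 1" for z
  proof -
    define \<phi> where "\<phi> z = K * \<bar>(cmod (hd z))\<^sup>2 - (cmod (gd z))\<^sup>2\<bar> - (cmod (hd z) + cmod (gd z))\<^sup>2" for z
    have "AE z\<in>ball 0 1 in lborel. (norm_D f z)\<^sup>2 \<le> K * \<bar>(cmod (wirt_dz f z))\<^sup>2 - (cmod (wirt_dzbar f z))\<^sup>2\<bar>"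
      using qc unfolding quasiconformal_def by auto
    hence "AE z\<in>ball 0 1 in lborel. 0 \<le> \<phi> z"
      by eventually_elim (use N W(2,3) in \<open>auto simp: \<phi>_def hd_def gd_def\<close>)
    hence "0 \<le> \<phi> z" by (intro AE_nonneg_imp_nonneg[OF open_ball _ _ z])
        (auto simp: \<phi>_def intro!: continuous_intros cont)
    moreover have "(cmod (hd z))\<^sup>2 - (cmod (gd z))\<^sup>2 = (cmod (hd z) + cmod (gd z)) * (cmod (hd z) - cmod (gd z))"
      by (simp add: power2_eq_square algebra_simps)
    ultimately have "(cmod (hd z) + cmod (gd z)) * (cmod (hd z) + cmod (gd z))
       \<le> (cmod (hd z) + cmod (gd z)) * (K * \<bar>cmod (hd z) - cmod (gd z)\<bar>)"
      by (simp add: \<phi>_def abs_mult power2_eq_square mult_ac)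
    thus ?thesis using pos[OF z] N[OF z] by (simp add: mult_le_cancel_left_pos)
  qed
  \<comment> \<open>Equal moduli would make the right side of \<open>dil\<close> vanish, against
    \<open>pos\<close>.\<close>
  have ne: "cmod (hd z) \<noteq> cmod (gd z)" if "z \<in> ball 0 1" for z
    using dil[OF that] pos[OF that] N[OF that] by auto
  text \<open>By connectedness of the disc one of the two analytic parts dominates everywhere; since
    \<open>norm_D\<close> is symmetric in them, it does not matter which.\<close>
  have "(\<forall>z\<in>ball 0 1. cmod (gd z) < cmod (hd z)) \<or> (\<forall>z\<in>ball 0 1. cmod (hd z) < cmod (gd z))"
  proof (rule ccontr)
    define d where "d z = cmod (hd z) - cmod (gd z)" for z
    assume "\<not> ?thesis"
    then obtain z w where zw: "z \<in> ball 0 1" "w \<in> ball 0 1" "d z \<le> 0" "0 \<le> d w"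
      by (auto simp: d_def not_less)
    have "connected (d ` ball 0 1)" unfolding d_def
      by (intro connected_continuous_image continuous_intros cont connected_ball)
    hence "{d z..d w} \<subseteq> d ` ball 0 1" using zw by (intro connected_contains_Icc) auto
    hence "0 \<in> d ` ball 0 1" using zw by auto
    thus False using ne by (auto simp: d_def)
  qed
  then obtain p q where pq: "p = hd \<and> q = gd \<or> p = gd \<and> q = hd" "\<And>z. z \<in> ball 0 1 \<Longrightarrow> cmod (q z) < cmod (p z)"
    by blast
  have Npq: "norm_D f z = cmod (p z) + cmod (q z)" if "z \<in> ball 0 1" for z
    using N[OF that] pq(1) by auto
  obtain M where M: "\<And>r w1 w2. 0 < r \<Longrightarrow> r < 1 \<Longrightarrow> w1 \<in> f ` sphere 0 r \<Longrightarrow> w2 \<in> f ` sphere 0 r \<Longrightarrow> w1 \<noteq> w2 \<Longrightarrow>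
      smaller_subarc_length f r w1 w2 / internal_dist (f ` ball 0 r) w1 w2 \<le> M"
    using assms(3) unfolding bounded_pommerenke_interior_domain_def pommerenke_interior_domain_def bdd_above_def
    by blast
  \<comment> \<open>The locale asks for a positive constant, and the bound \<open>M\<close> comes
    without a sign; hence \<open>max M 1\<close>.\<close>
  interpret harmonic_disc_map f hd gd p q K C6 C7 \<delta>3 \<delta>4 "max M 1"
  proof
    show "p holomorphic_on ball 0 1" "q holomorphic_on ball 0 1" using pq(1) hol by auto
    show "cmod (p z) + cmod (q z) \<le> K * (cmod (p z) - cmod (q z))" if "z \<in> ball 0 1" for z
      using dil[OF that] pq(1) pq(2)[OF that] by auto
    show "(f has_derivative (\<lambda>v. hd z * v + cnj (gd z * v))) (at z)" if "z \<in> ball 0 1" for z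
      using W(1)[OF _ that] by (simp add: hd_def gd_def)
    fix \<zeta> :: complex and \<rho>1 \<rho>2 :: real
    assume \<rho>: "cmod \<zeta> = 1" "0 \<le> \<rho>1" "\<rho>1 \<le> \<rho>2" "\<rho>2 < 1"
    hence "of_real \<rho>1 * \<zeta> \<in> ball 0 1" "of_real \<rho>2 * \<zeta> \<in> ball 0 1" by (auto simp: norm_mult)
    thus "C6 * ((1 - \<rho>1) / (1 - \<rho>2)) powr (\<delta>3 - 1) * (cmod (p (of_real \<rho>1 * \<zeta>)) + cmod (q (of_real \<rho>1 * \<zeta>)))
             \<le> cmod (p (of_real \<rho>2 * \<zeta>)) + cmod (q (of_real \<rho>2 * \<zeta>)) \<and>
           cmod (p (of_real \<rho>2 * \<zeta>)) + cmod (q (of_real \<rho>2 * \<zeta>))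
             \<le> C7 * ((1 - \<rho>2) / (1 - \<rho>1)) powr (\<delta>4 - 1) * (cmod (p (of_real \<rho>1 * \<zeta>)) + cmod (q (of_real \<rho>1 * \<zeta>)))"
      using radial[of \<zeta> \<rho>1 \<rho>2] \<rho> Npq by simp
  next
    show "smaller_subarc_length f r w1 w2 / internal_dist (f ` ball 0 r) w1 w2 \<le> max M 1"
      if "0 < r" "r < 1" "w1 \<in> f ` sphere 0 r" "w2 \<in> f ` sphere 0 r" "w1 \<noteq> w2" for r w1 w2
      using M[OF that] by simp
  qed (use assms pq inj in auto)
  obtain C where C: "\<And>\<zeta>. \<zeta> \<in> ball 0 1 \<Longrightarrow>
     (\<integral>\<^sup>+\<theta>\<in>{0..2 * pi}. ennreal (1 / (2 * pi) * (norm_D_bdry f (cis \<theta>) / norm_D f \<zeta>)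
        * ((1 - (cmod \<zeta>)\<^sup>2) / (cmod (cis \<theta> - \<zeta>))\<^sup>2)) \<partial>lborel) \<le> ennreal C"
    using poisson_bdry_bound Npq unfolding stretch_def by blast
  have "(SUP \<zeta>\<in>ball 0 1. \<integral>\<^sup>+\<theta>\<in>{0..2 * pi}. ennreal (1 / (2 * pi) * (norm_D_bdry f (cis \<theta>) / norm_D f \<zeta>)
        * ((1 - (cmod \<zeta>)\<^sup>2) / (cmod (cis \<theta> - \<zeta>))\<^sup>2)) \<partial>lborel) \<le> ennreal C"
    by (rule SUP_least) (rule C)
  also have "\<dots> < \<infinity>" by simp
  finally show ?thesis .
qed

end
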